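(* Let $n\ge2$, let $(X_k)_{k\ge1}$ be a sequence of independent identically distributed random variables with $\mathbb E[X_k]=0$ and $\mathbb E[X_k^2]=1$, $k\ge1$, and let $A=(a_{k,l})_{1\le k,l\le n}$ be a real symmetric matrix with vanishing diagonal. Let $$Q_n:=\sum_{1\le k,l\le n}a_{k,l}X_kX_l$$ be normalized so that $\mathbb E[Q_n]=0$ and $\mathbb E[Q_n^2]=1$. Then $$d_W(Q_n,\mathcal N)\le2\sqrt{\mathbb E[X_1^4]\sum_{l=1}^n\Big(\sum_{k=1}^na_{k,l}^2\Big)^2+2\sum_{1\le l,p\le n}\Big(\sum_{k=1}^na_{k,l}a_{k,p}\Big)^2}+4\sqrt{\Big(3\,\mathbb E[X_1^4]+(\mathbb E[X_1^4])^2\Big)\sum_{k=1}^n\Big(\sum_{l=1}^na_{k,l}^2\Big)^2}.$$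
   Context: $\mathcal N$ is a standard normal random variable, and $d_W(X,Y)=\sup_h|\mathbb E[h(X)]-\mathbb E[h(Y)]|$ over Lipschitz $h:\mathbb R\to\mathbb R$ with constant at most $1$. The right-hand side may be $+\infty$. *)

theory Defs
  imports "HOL-Probability.Probability"
begin

text \<open>
  Wasserstein distance of two integrable real random variables, possibly living on different
  probability spaces.  Integrability of \<^term>\<open>X\<close> and \<^term>\<open>Y\<close> makes every \<^term>\<open>h (X \<omega>)\<close>
  and \<^term>\<open>h (Y \<omega>)\<close> integrable; without it the Bochner integral defaults to 0 and the
  definition is not meaningful.
\<close>
definition wasserstein_dist ::
  "'a measure \<Rightarrow> ('a \<Rightarrow> real) \<Rightarrow> 'b measure \<Rightarrow> ('b \<Rightarrow> real) \<Rightarrow> ennreal" where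
  "wasserstein_dist M X N Y =
     (SUP h\<in>{h :: real \<Rightarrow> real. 1-lipschitz_on UNIV h}.
        ennreal \<bar>(\<integral>\<omega>. h (X \<omega>) \<partial>M) - (\<integral>\<omega>. h (Y \<omega>) \<partial>N)\<bar>)"

definition quadratic_form_rv ::
  "nat \<Rightarrow> (nat \<Rightarrow> nat \<Rightarrow> real) \<Rightarrow> (nat \<Rightarrow> 'a \<Rightarrow> real) \<Rightarrow> 'a \<Rightarrow> real" where
  "quadratic_form_rv n a X \<omega> = (\<Sum>k=1..n. \<Sum>l=1..n. a k l * X k \<omega> * X l \<omega>)"

text \<open>The fourth moment is taken as a nonnegative integral, so that it may be infinite.\<close>
definition fourth_moment :: "'a measure \<Rightarrow> ('a \<Rightarrow> real) \<Rightarrow> ennreal" where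
  "fourth_moment M X = (\<integral>\<^sup>+\<omega>. ennreal (X \<omega> ^ 4) \<partial>M)"

definition ennreal_sqrt :: "ennreal \<Rightarrow> ennreal" where
  "ennreal_sqrt x = (if x = \<infinity> then \<infinity> else ennreal (sqrt (enn2real x)))"

lemma ennreal_sqrt_ennreal: "0 \<le> x \<Longrightarrow> ennreal_sqrt (ennreal x) = ennreal (sqrt x)"
  by (simp add: ennreal_sqrt_def)

end

theory Submission
  imports Defs "HOL-Real_Asymp.Real_Asymp"
begin

text \<open>
  The proof is Stein's method. Let \<open>f\<close> solve \<open>f' w - w f w = h w - E h(N)\<close> for a continuously
  differentiable \<open>h\<close> with \<open>\<bar>h'\<bar> \<le> 1\<close>; then \<open>\<bar>f'\<bar> \<le> 1\<close> and \<open>\<bar>f''\<bar> \<le> 2\<close>. Write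
  \<open>Q = \<Sum>\<^sub>k X\<^sub>k T\<^sub>k\<close> with \<open>T\<^sub>k = \<Sum>\<^sub>l a\<^sub>k\<^sub>l X\<^sub>l\<close>, so that \<open>Q = V\<^sub>k + 2 X\<^sub>k T\<^sub>k\<close> with \<open>X\<^sub>k\<close> independent of
  \<open>(T\<^sub>k, V\<^sub>k)\<close>. For a standardized variable \<open>X\<close> and a smooth \<open>g\<close>, symmetrization with an independent
  copy of \<open>X\<close> gives \<open>\<bar>E (X g(X) - g'(X))\<bar> \<le> sup \<bar>g''\<bar> E \<bar>X\<bar>\<^sup>3 / 2\<close>. Applied to
  \<open>g(x) = t f(v + 2 x t)\<close> it replaces \<open>E Q f(Q)\<close> by \<open>E f'(Q) 2 \<Sum>\<^sub>k T\<^sub>k\<^sup>2\<close> up to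
  \<open>4 \<Sum>\<^sub>k E \<bar>X\<^sub>k\<bar>\<^sup>3 E \<bar>T\<^sub>k\<bar>\<^sup>3\<close>, which by Cauchy-Schwarz is at most the second term of the bound. What
  remains is \<open>E \<bar>1 - 2 \<Sum>\<^sub>k T\<^sub>k\<^sup>2\<bar>\<close>, at most the standard deviation of a quadratic form with the
  matrix \<open>2 A\<^sup>2\<close>; this is at most the first term.
\<close>

subsection \<open>The Mills ratio\<close>

lemma has_field_derivative_std_normal_density [derivative_intros]:
  "(std_normal_density has_real_derivative - x * std_normal_density x) (at x)"
  unfolding std_normal_density_def
  by (auto intro!: derivative_eq_intros simp: field_simps)

lemma std_normal_density_minus: "std_normal_density (- x) = std_normal_density x"
  by (simp add: std_normal_density_def)

lemma std_normal_density_pos: "std_normal_density x > 0"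
  by (simp add: normal_density_pos)

lemma std_normal_density_le_half: "std_normal_density x \<le> 1 / 2"
proof -
  have "sqrt (2 * pi) \<ge> sqrt (2 * 2)"
    using pi_ge_two by (intro real_sqrt_le_mono) auto
  then have "2 \<le> sqrt (2 * pi)" by (simp only: real_sqrt_mult) simp
  moreover have "exp (- x\<^sup>2 / 2) \<le> 1" by simp
  ultimately have "exp (- x\<^sup>2 / 2) / sqrt (2 * pi) \<le> 1 / 2"
    by (intro frac_le) auto
  then show ?thesis by (simp add: std_normal_density_def)
qed

lemma isCont_std_normal_density: "isCont std_normal_density x"
  by (rule DERIV_isCont[OF has_field_derivative_std_normal_density])

lemma tendsto_std_normal_density_at_bot: "(std_normal_density \<longlongrightarrow> 0) at_bot"
  unfolding std_normal_density_def by real_asymp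

lemma tendsto_mult_std_normal_density_at_bot: "((\<lambda>x. x * std_normal_density x) \<longlongrightarrow> 0) at_bot"
  unfolding std_normal_density_def by real_asymp

lemma tendsto_std_normal_density_at_top: "(std_normal_density \<longlongrightarrow> 0) at_top"
  unfolding std_normal_density_def by real_asymp

lemma tendsto_mult_std_normal_density_at_top: "((\<lambda>x. x * std_normal_density x) \<longlongrightarrow> 0) at_top"
  unfolding std_normal_density_def by real_asymp

text \<open>\<open>F\<close> is nondecreasing up to \<open>c\<close>, so its limit 0 at minus
  infinity is a lower bound for \<open>F c\<close>. This turns inequalities between Gaussian tail
  functions into sign checks on derivatives.\<close>

lemma nonneg_of_DERIV_nonneg_at_bot:
  fixes F :: "real \<Rightarrow> real"
  assumes D: "\<And>x. x \<le> c \<Longrightarrow> (F has_real_derivative F' x) (at x)"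
    and nonneg: "\<And>x. x \<le> c \<Longrightarrow> F' x \<ge> 0"
    and lim: "(F \<longlongrightarrow> 0) at_bot"
  shows "F c \<ge> 0"
proof (rule tendsto_upperbound[OF lim])
  have "F y \<le> F c" if "y \<le> c" for y
    using that by (rule DERIV_nonneg_imp_nondecreasing) (use D nonneg in blast)
  then show "\<forall>\<^sub>F y in at_bot. F y \<le> F c"
    by (rule eventually_mono[OF eventually_le_at_bot[of c]])
qed simp

text \<open>Splitting at \<open>w - 1\<close> leaves a constant plus an integral over a compact
  interval, to which the fundamental theorem of calculus applies at the interior point
  \<open>w\<close>.\<close>

lemma has_field_derivative_LINT_atMost:
  fixes g :: "real \<Rightarrow> real"
  assumes cont: "\<And>x. isCont g x" and int: "\<And>w. set_integrable lborel {..w} g"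
  shows "((\<lambda>w. LINT x:{..w}|lborel. g x) has_real_derivative g w) (at w)"
proof -
  have [measurable]: "g \<in> borel_measurable borel"
    using cont by (intro borel_measurable_continuous_onI) (simp add: continuous_at_imp_continuous_on)
  have eq: "(LINT x:{..y}|lborel. g x) = (LINT x:{..w-1}|lborel. g x) + integral {w-1..y} g"
    if "y \<ge> w - 1" for y
  proof -
    have *: "{..y} = {..w-1} \<union> {w-1<..y}" using that by auto
    have i: "set_integrable lborel {w-1..y} g"
      by (rule borel_integrable_atLeastAtMost') (use cont in \<open>auto simp: continuous_at_imp_continuous_on\<close>)
    have "(LINT x:{..y}|lborel. g x) = (LINT x:{..w-1}|lborel. g x) + (LINT x:{w-1<..y}|lborel. g x)"
      unfolding * by (intro set_integral_Un) (auto intro: int set_integrable_subset[OF i])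
    \<comment> \<open>The added endpoint is a null set.\<close>
    also have "(LINT x:{w-1<..y}|lborel. g x) = (LINT x:{w-1..y}|lborel. g x)"
      unfolding set_lebesgue_integral_def
      by (intro integral_cong_AE)
         (use AE_lborel_singleton[of "w-1"] in \<open>auto split: split_indicator elim!: eventually_mono\<close>)
    also have "\<dots> = integral {w-1..y} g"
      by (rule set_borel_integral_eq_integral[OF i])
    finally show ?thesis .
  qed
  have "((\<lambda>y. integral {w-1..y} g) has_real_derivative g w) (at w within {w-1..w+1})"
    by (rule integral_has_real_derivative) (use cont in \<open>auto simp: continuous_at_imp_continuous_on\<close>)
  then have "((\<lambda>y. integral {w-1..y} g) has_real_derivative g w) (at w)"
    by (subst (asm) at_within_interior) auto
  then have "((\<lambda>y. (LINT x:{..w-1}|lborel. g x) + integral {w-1..y} g) has_real_derivative g w) (at w)"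
    by (auto intro!: derivative_eq_intros)
  then show ?thesis
    by (rule has_field_derivative_transform_within_open[where S="{w-1<..}"])
       (auto intro: eq[symmetric])
qed

section \<open>The normal distribution function and its lower tail\<close>

definition Phi :: "real \<Rightarrow> real" where
  "Phi x = (LINT t:{..x}|lborel. std_normal_density t)"

lemma has_field_derivative_Phi [derivative_intros]:
  "(Phi has_real_derivative std_normal_density x) (at x)"
  unfolding Phi_def[abs_def]
  by (rule has_field_derivative_LINT_atMost)
     (auto intro: isCont_std_normal_density integrable_normal_density
        set_integrable_subset[of lborel UNIV, OF _ _ subset_UNIV] simp: set_integrable_def[of _ UNIV])

text \<open>The integral form of \<open>Phi\<close> gives its derivative; the form as a distribution
  function gives its sign and its limits at both infinities.\<close>

lemma Phi_eq_cdf: "Phi x = cdf std_normal_distribution x"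
proof -
  have "cdf std_normal_distribution x = (\<integral>t. indicator {..x} t \<partial>std_normal_distribution)"
    by (simp add: cdf_def)
  also have "\<dots> = (\<integral>t. std_normal_density t *\<^sub>R indicator {..x} t \<partial>lborel)"
    by (rule integral_density) auto
  also have "\<dots> = Phi x" by (simp add: Phi_def set_lebesgue_integral_def mult.commute)
  finally show ?thesis by simp
qed

lemma Phi_nonneg: "Phi x \<ge> 0"
  by (simp add: Phi_eq_cdf cdf_def)

lemma tendsto_Phi_at_bot: "(Phi \<longlongrightarrow> 0) at_bot"
  using finite_borel_measure.cdf_lim_at_bot[OF real_distribution.finite_borel_measure_M[OF real_dist_normal_dist]]
  by (simp add: Phi_eq_cdf[abs_def])

lemma tendsto_Phi_at_top: "(Phi \<longlongrightarrow> 1) at_top"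
  using real_distribution.cdf_lim_at_top_prob[OF real_dist_normal_dist]
  by (simp add: Phi_eq_cdf[abs_def])

text \<open>The sum \<open>Phi y + Phi (- y)\<close> has derivative zero because the density is
  even; its limit at infinity shows that the constant is 1.\<close>

lemma Phi_minus: "Phi (- x) = 1 - Phi x"
proof -
  have "((\<lambda>y. Phi y + Phi (- y)) has_real_derivative 0) (at y)" for y
    by (rule derivative_eq_intros DERIV_chain2[of Phi] refl)+ (simp add: std_normal_density_minus)
  then obtain c where c: "\<And>y. Phi y + Phi (- y) = c"
    using DERIV_isconst_all[of "\<lambda>y. Phi y + Phi (- y)"] by blast
  have "((\<lambda>y. Phi y + Phi (- y)) \<longlongrightarrow> 1 + 0) at_top"
    by (intro tendsto_add tendsto_Phi_at_top filterlim_compose[OF tendsto_Phi_at_bot]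
        filterlim_uminus_at_bot_at_top)
  then have "c = 1" by (simp add: c tendsto_const_iff)
  with c[of x] show ?thesis by simp
qed

text \<open>For \<open>x \<le> -1\<close> the derivative
  \<open>(- x - 1) * std_normal_density x\<close> of the difference is nonnegative. This tail bound
  makes \<open>Phi\<close> times a power of \<open>x\<close> vanish at minus infinity.\<close>

lemma Phi_le_density: "w \<le> -1 \<Longrightarrow> Phi w \<le> std_normal_density w"
proof -
  assume w: "w \<le> -1"
  have "0 \<le> std_normal_density w - Phi w"
  proof (rule nonneg_of_DERIV_nonneg_at_bot[where c=w and
        F="\<lambda>x. std_normal_density x - Phi x" and F'="\<lambda>x. (- x - 1) * std_normal_density x"])
    show "((\<lambda>x. std_normal_density x - Phi x) has_real_derivative (- x - 1) * std_normal_density x) (at x)"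
      if "x \<le> w" for x
      by (rule derivative_eq_intros refl)+ (simp add: algebra_simps)
    show "((\<lambda>x. std_normal_density x - Phi x) \<longlongrightarrow> 0) at_bot"
      using tendsto_diff[OF tendsto_std_normal_density_at_bot tendsto_Phi_at_bot] by simp
    show "0 \<le> (- x - 1) * std_normal_density x" if "x \<le> w" for x
      using that w std_normal_density_pos[of x] by (intro mult_nonneg_nonneg) (auto simp: less_imp_le)
  qed
  then show ?thesis by simp
qed

lemma tendsto_square_mult_Phi_at_bot: "((\<lambda>x. x\<^sup>2 * Phi x) \<longlongrightarrow> 0) at_bot"
proof (rule Lim_null_comparison)
  show "\<forall>\<^sub>F x in at_bot. norm (x\<^sup>2 * Phi x) \<le> x\<^sup>2 * std_normal_density x"
    using eventually_le_at_bot[of "-1"]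
    by eventually_elim (auto simp: abs_mult Phi_nonneg intro!: mult_left_mono Phi_le_density)
  show "((\<lambda>x. x\<^sup>2 * std_normal_density x) \<longlongrightarrow> 0) at_bot"
    unfolding std_normal_density_def by real_asymp
qed

lemma tendsto_mult_Phi_at_bot: "((\<lambda>x. x * Phi x) \<longlongrightarrow> 0) at_bot"
proof (rule Lim_null_comparison[OF _ tendsto_mult_std_normal_density_at_bot[THEN tendsto_rabs_zero]])
  show "\<forall>\<^sub>F x in at_bot. norm (x * Phi x) \<le> \<bar>x * std_normal_density x\<bar>"
    using eventually_le_at_bot[of "-1"]
    by eventually_elim (auto simp: abs_mult Phi_nonneg intro!: mult_left_mono Phi_le_density)
qed

text \<open>The antiderivative of \<^const>\<open>Phi\<close> that vanishes at \<open>-\<infinity>\<close>; it equals \<open>E (w - Z)\<^sup>+\<close>.\<close>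
definition Psi :: "real \<Rightarrow> real" where
  "Psi w = std_normal_density w + w * Phi w"

lemma has_field_derivative_Psi [derivative_intros]: "(Psi has_real_derivative Phi x) (at x)"
  unfolding Psi_def[abs_def]
  by (rule derivative_eq_intros refl)+ simp

lemma tendsto_Psi_at_bot: "(Psi \<longlongrightarrow> 0) at_bot"
  unfolding Psi_def[abs_def]
  using tendsto_add[OF tendsto_std_normal_density_at_bot tendsto_mult_Phi_at_bot] by simp

lemma Psi_nonneg: "Psi w \<ge> 0"
  by (rule nonneg_of_DERIV_nonneg_at_bot[where F=Psi and F'=Phi])
     (auto intro: has_field_derivative_Psi Phi_nonneg tendsto_Psi_at_bot)

lemma Psi_minus: "Psi (- w) = Psi w - w"
  by (simp add: Psi_def Phi_minus std_normal_density_minus algebra_simps)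

text \<open>The left-hand side vanishes at minus infinity and has derivative \<open>2 * Psi\<close>.
  Divided by the density and used at \<open>w\<close> and \<open>- w\<close>, it gives the signs of
  two coefficients in the second derivative of the Stein solution.\<close>

lemma mills_lower: "(1 + w\<^sup>2) * Phi w + w * std_normal_density w \<ge> 0"
proof (rule nonneg_of_DERIV_nonneg_at_bot[where c=w and
      F="\<lambda>w. (1 + w\<^sup>2) * Phi w + w * std_normal_density w" and F'="\<lambda>x. 2 * Psi x"])
  show "((\<lambda>w. (1 + w\<^sup>2) * Phi w + w * std_normal_density w) has_real_derivative 2 * Psi x) (at x)"
    if "x \<le> w" for x
    by (rule derivative_eq_intros refl)+ (simp add: Psi_def algebra_simps power2_eq_square)
  have "((\<lambda>w. Phi w + w^2 * Phi w + w * std_normal_density w) \<longlongrightarrow> 0 + 0 + 0) at_bot"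
    by (intro tendsto_add tendsto_Phi_at_bot tendsto_square_mult_Phi_at_bot
        tendsto_mult_std_normal_density_at_bot)
  then show "((\<lambda>w. (1 + w\<^sup>2) * Phi w + w * std_normal_density w) \<longlongrightarrow> 0) at_bot"
    by (simp add: algebra_simps)
qed (auto simp: Psi_nonneg)

text \<open>Birnbaum's bound on the Mills ratio.\<close>
lemma mills_lower_sqrt: "(sqrt (x\<^sup>2 + 4) + x) / 2 * std_normal_density x \<le> Phi x"
proof -
  define q :: "real \<Rightarrow> real" where "q = (\<lambda>x. (sqrt (x\<^sup>2 + 4) + x) / 2)"
  have pos: "x\<^sup>2 + 4 > 0" for x :: real by (simp add: add_nonneg_pos)
  have q0: "q x > 0" for x
  proof -
    have "\<bar>x\<bar> < sqrt (x\<^sup>2 + 4)" by (rule real_less_rsqrt) simp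
    then show ?thesis by (simp add: q_def)
  qed
  \<comment> \<open>\<open>q x\<close> is the positive root of this quadratic equation, which
    replaces the square root in what follows.\<close>
  have q2: "(q x)\<^sup>2 = 1 + x * q x" for x
  proof -
    have "(sqrt (x\<^sup>2 + 4))\<^sup>2 = x\<^sup>2 + 4" by simp
    then show ?thesis by (simp add: q_def power_divide power2_sum distrib_left add_divide_distrib power2_eq_square[of x])
  qed
  \<comment> \<open>By \<open>q2\<close>, the derivative of the difference is the density times the
    square of \<open>q\<close> minus the derivative of \<open>q\<close>.\<close>
  have "0 \<le> Phi x - q x * std_normal_density x"
  proof (rule nonneg_of_DERIV_nonneg_at_bot[where c=x and
        F="\<lambda>x. Phi x - q x * std_normal_density x" and
        F'="\<lambda>x. ((q x)\<^sup>2 - (x / sqrt (x\<^sup>2 + 4) + 1) / 2) * std_normal_density x"])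
    show "((\<lambda>x. Phi x - q x * std_normal_density x) has_real_derivative
        ((q x)\<^sup>2 - (x / sqrt (x\<^sup>2 + 4) + 1) / 2) * std_normal_density x) (at x)" for x
      unfolding q2 unfolding q_def using pos[of x]
      by (auto intro!: derivative_eq_intros simp: field_simps)
    show "0 \<le> ((q x)\<^sup>2 - (x / sqrt (x\<^sup>2 + 4) + 1) / 2) * std_normal_density x" for x
    proof (rule mult_nonneg_nonneg)
      have s: "sqrt (x\<^sup>2 + 4) = 2 * q x - x" by (simp add: q_def field_simps)
      have sp: "2 * q x - x > 0" using pos[of x] s by (metis real_sqrt_gt_zero)
      have "(x / sqrt (x\<^sup>2 + 4) + 1) / 2 = q x / (2 * q x - x)"
        unfolding s using sp by (simp add: field_simps)
      \<comment> \<open>By \<open>q2\<close>, the product \<open>q x * (2 * q x - x)\<close> is 1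
        plus a square, hence at least 1.\<close>
      also have "\<dots> \<le> (q x)\<^sup>2"
      proof -
        have "q x * 1 \<le> q x * (q x * (2 * q x - x))"
        proof (rule mult_left_mono)
          have "q x * (2 * q x - x) = (q x)\<^sup>2 + 1"
            using q2[of x] by (simp add: algebra_simps power2_eq_square)
          then show "1 \<le> q x * (2 * q x - x)" by simp
        qed (use q0[of x] in simp)
        then show ?thesis using sp by (simp add: field_simps power2_eq_square)
      qed
      finally show "0 \<le> (q x)\<^sup>2 - (x / sqrt (x\<^sup>2 + 4) + 1) / 2" by simp
    qed (simp add: less_imp_le[OF std_normal_density_pos])
    have "((\<lambda>x. q x * std_normal_density x) \<longlongrightarrow> 0) at_bot"
      unfolding q_def std_normal_density_def by real_asymp
    from tendsto_diff[OF tendsto_Phi_at_bot this]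
    show "((\<lambda>x. Phi x - q x * std_normal_density x) \<longlongrightarrow> 0) at_bot" by simp
  qed
  then show ?thesis by (simp add: q_def)
qed

text \<open>This inequality lies behind the bound 1 on the derivative of the Stein solution. By
  symmetry \<open>w \<ge> 0\<close>. Birnbaum's bound at \<open>- w\<close> controls
  \<open>Psi (- w)\<close> by the density times the square of a root \<open>q\<close>, and with
  \<open>Psi w = w + Psi (- w)\<close> everything becomes a polynomial in \<open>q\<close> times the
  density.\<close>

lemma Psi_mult_Psi_minus_le: "2 * (Psi w * Psi (- w)) \<le> std_normal_density w"
proof -
  have main: "2 * (Psi w * Psi (- w)) \<le> std_normal_density w" if w: "w \<ge> 0" for w
  proof -
    define q where "q = (sqrt (w\<^sup>2 + 4) - w) / 2"
    define d where "d = std_normal_density w"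
    have d: "0 < d" "d \<le> 1 / 2" using std_normal_density_pos[of w] std_normal_density_le_half[of w] by (auto simp: d_def)
    have "w < sqrt (w\<^sup>2 + 4)" by (rule real_less_rsqrt) simp
    then have q0: "q > 0" by (simp add: q_def)
    have q2: "q\<^sup>2 = 1 - w * q"
    proof -
      have "(sqrt (w\<^sup>2 + 4))\<^sup>2 = w\<^sup>2 + 4" by simp
      then show ?thesis
        by (simp add: q_def power_divide power2_diff right_diff_distrib diff_divide_distrib add_divide_distrib power2_eq_square[of w])
    qed
    have "q \<le> 1"
    proof -
      have "q\<^sup>2 \<le> 1\<^sup>2" using q2 w q0 by simp
      then show ?thesis by (rule power2_le_imp_le) simp
    qed
    have "q * d \<le> Phi (- w)"
      using mills_lower_sqrt[of "-w"] by (simp add: q_def d_def std_normal_density_minus)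
    then have "w * (q * d) \<le> w * Phi (- w)" using w by (rule mult_left_mono)
    then have "Psi (- w) \<le> d - w * (q * d)" by (simp add: Psi_def std_normal_density_minus d_def)
    also have "\<dots> = q\<^sup>2 * d" unfolding q2 by (simp add: algebra_simps)
    finally have le: "Psi (- w) \<le> q\<^sup>2 * d" .
    have "2 * (Psi w * Psi (- w)) = 2 * ((w + Psi (- w)) * Psi (- w))" by (simp add: Psi_minus)
    \<comment> \<open>Only one of the two occurrences of \<open>d\<close> is replaced by 1/2; the
      other one is the density in the claim.\<close>
    also have "\<dots> \<le> 2 * ((w + q\<^sup>2 * (1/2)) * (q\<^sup>2 * d))"
    proof -
      have "q\<^sup>2 * d \<le> q\<^sup>2 * (1/2)" using d by (intro mult_left_mono) auto
      then have "(w + Psi (- w)) * Psi (- w) \<le> (w + q\<^sup>2 * (1/2)) * (q\<^sup>2 * d)"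
        using w le Psi_nonneg[of "-w"] by (intro mult_mono) auto
      then show ?thesis by simp
    qed
    also have "\<dots> = d * (2 * (w * q) * q + q ^ 4)" by (simp add: algebra_simps power2_eq_square power4_eq_xxxx)
    also have "w * q = 1 - q\<^sup>2" using q2 by simp
    \<comment> \<open>The factorization shows that what is subtracted from 1 is nonnegative for
      \<open>q\<close> between 0 and 1.\<close>
    also have "d * (2 * (1 - q\<^sup>2) * q + q ^ 4) = d * (1 - (1 - q) ^ 3 * (1 + q))"
      by (simp add: algebra_simps power2_eq_square power3_eq_cube power4_eq_xxxx)
    also have "\<dots> \<le> d * 1"
      using d q0 \<open>q \<le> 1\<close> by (intro mult_left_mono) auto
    finally show ?thesis by (simp add: d_def)
  qed
  show ?thesis
  proof (cases "w \<ge> 0")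
    case False
    then show ?thesis using main[of "-w"] by (simp add: std_normal_density_minus mult.commute)
  qed (rule main)
qed

subsection \<open>The Stein equation\<close>

text \<open>\<open>Psi\<close> is an antiderivative of the nonnegative function \<open>Phi\<close>
  with limit 0 at minus infinity, so the improper fundamental theorem yields integrability and value
  together.\<close>

lemma
  shows set_integrable_Phi_atMost: "set_integrable lborel {..w} Phi"
    and LINT_Phi_atMost: "(LINT x:{..w}|lborel. Phi x) = Psi w"
proof -
  have lim: "((Psi \<circ> real_of_ereal) \<longlongrightarrow> 0) (at_right (- \<infinity>))"
    "((Psi \<circ> real_of_ereal) \<longlongrightarrow> Psi v) (at_left (ereal v))" for v
    unfolding ereal_tendsto_simps1
    using tendsto_Psi_at_bot DERIV_isCont[OF has_field_derivative_Psi]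
    by (auto simp: isCont_def intro: tendsto_mono[OF at_le])
  have FTC: "set_integrable lborel (einterval (-\<infinity>) (ereal v)) Phi"
      "(LBINT x=-\<infinity>..ereal v. Phi x) = Psi v - 0" for v
    using interval_integral_FTC_nonneg[of "-\<infinity>" "ereal v" Psi Phi, OF _ has_field_derivative_Psi
        DERIV_isCont[OF has_field_derivative_Phi] _ lim] Phi_nonneg by auto
  \<comment> \<open>The open interval has to contain the closed endpoint \<open>w\<close>, hence
    \<open>w + 1\<close>.\<close>
  show "set_integrable lborel {..w} Phi"
    by (rule set_integrable_subset[OF FTC(1)[of "w+1"]]) (auto simp: einterval_iff)
  have "(LBINT x=-\<infinity>..ereal w. Phi x) = (LBINT x:{x. -\<infinity> < ereal x \<and> ereal x \<le> ereal w}. Phi x)"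
    by (rule interval_integral_Ioc') simp
  then show "(LINT x:{..w}|lborel. Phi x) = Psi w"
    using FTC(2)[of w] by (simp add: atMost_def)
qed

text \<open>The integrand is dominated by \<open>Phi\<close>, whose integral is \<open>Psi\<close>.
  With \<open>g\<close> the derivative of the test function, these integrals are the building blocks
  of the Stein solution.\<close>

lemma
  fixes g :: "real \<Rightarrow> real"
  assumes cont: "\<And>x. isCont g x" and bound: "\<And>x. \<bar>g x\<bar> \<le> 1"
  shows has_field_derivative_LINT_mult_Phi:
      "((\<lambda>w. LINT x:{..w}|lborel. g x * Phi x) has_real_derivative g w * Phi w) (at w)"
    and abs_LINT_mult_Phi_le: "\<bar>LINT x:{..w}|lborel. g x * Phi x\<bar> \<le> Psi w"
proof -
  have contgP: "isCont (\<lambda>x. g x * Phi x) x" for x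
    by (intro isCont_mult cont DERIV_isCont[OF has_field_derivative_Phi])
  have [measurable]: "(\<lambda>x. g x * Phi x) \<in> borel_measurable borel"
    using contgP by (intro borel_measurable_continuous_onI) (simp add: continuous_at_imp_continuous_on)
  have le: "\<bar>g x * Phi x\<bar> \<le> Phi x" for x
    using mult_right_mono[OF bound[of x] Phi_nonneg[of x]] by (simp add: abs_mult Phi_nonneg)
  have int: "set_integrable lborel {..w} (\<lambda>x. g x * Phi x)" for w
    by (rule set_integrable_bound[OF set_integrable_Phi_atMost])
       (use le in \<open>auto simp: set_borel_measurable_def Phi_nonneg\<close>)
  show "((\<lambda>w. LINT x:{..w}|lborel. g x * Phi x) has_real_derivative g w * Phi w) (at w)"
    by (rule has_field_derivative_LINT_atMost[OF contgP int])
  have "\<bar>LINT x:{..w}|lborel. g x * Phi x\<bar> \<le> (LINT x:{..w}|lborel. \<bar>g x * Phi x\<bar>)"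
    using set_integral_norm_bound[OF int] by simp
  also have "\<dots> \<le> (LINT x:{..w}|lborel. Phi x)"
    by (rule set_integral_mono) (use set_integrable_abs[OF int] set_integrable_Phi_atMost le in auto)
  finally show "\<bar>LINT x:{..w}|lborel. g x * Phi x\<bar> \<le> Psi w"
    by (simp add: LINT_Phi_atMost)
qed

section \<open>Solution of the Stein equation and bounds on its derivatives\<close>

lemma integrable_std_normal_density_mult_lipschitz:
  fixes h :: "real \<Rightarrow> real"
  assumes "1-lipschitz_on UNIV h"
  shows "integrable lborel (\<lambda>x. std_normal_density x * h x)"
proof (rule Bochner_Integration.integrable_bound)
  show "integrable lborel (\<lambda>x. std_normal_density x * \<bar>h 0\<bar> + std_normal_density x * \<bar>x\<bar> ^ 1)"
    by (intro Bochner_Integration.integrable_add integrable_std_normal_moment_abs integrable_mult_left) auto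
  have "h \<in> borel_measurable borel"
    by (intro borel_measurable_continuous_onI lipschitz_on_continuous_on[OF assms])
  then show "(\<lambda>x. std_normal_density x * h x) \<in> borel_measurable lborel" by measurable
  have "\<bar>h x\<bar> \<le> \<bar>h 0\<bar> + \<bar>x\<bar>" for x
    using lipschitz_onD[OF assms, of x 0] by (simp add: dist_real_def)
  then have "std_normal_density x * \<bar>h x\<bar> \<le> std_normal_density x * (\<bar>h 0\<bar> + \<bar>x\<bar>)" for x
    by (intro mult_left_mono) auto
  then show "AE x in lborel. norm (std_normal_density x * h x)
      \<le> norm (std_normal_density x * \<bar>h 0\<bar> + std_normal_density x * \<bar>x\<bar> ^ 1)"
    by (auto simp: abs_mult distrib_left)
qed

lemma lipschitz_onI_DERIV:
  fixes h :: "real \<Rightarrow> real"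
  assumes "\<And>x. (h has_real_derivative g x) (at x)" "\<And>x. \<bar>g x\<bar> \<le> C" "C \<ge> 0"
  shows "C-lipschitz_on UNIV h"
proof (rule lipschitz_onI)
  show "dist (h x) (h y) \<le> C * dist x y" for x y
    using field_differentiable_bound[of UNIV h g C x y] assms
    by (auto simp: dist_real_def)
qed fact

text \<open>The product of \<open>f\<close> and the density has derivative
  \<open>std_normal_density x * (h x - c)\<close> and vanishes at both infinities, so this
  derivative integrates to zero. It identifies a constant that \<open>stein_solution\<close> first
  obtains without its value.\<close>

lemma stein_operator_expectation_zero:
  fixes f h :: "real \<Rightarrow> real"
  assumes f: "\<And>x. (f has_real_derivative f' x) (at x)" and f': "\<And>x. \<bar>f' x\<bar> \<le> 1"
    and eq: "\<And>w. f' w - w * f w = h w - c" and h: "1-lipschitz_on UNIV h"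
  shows "c = (\<integral>x. std_normal_density x * h x \<partial>lborel)"
proof -
  have flip: "1-lipschitz_on UNIV f" by (rule lipschitz_onI_DERIV[OF f f']) simp
  have fle: "\<bar>f x\<bar> \<le> \<bar>f 0\<bar> + \<bar>x\<bar>" for x
    using lipschitz_onD[OF flip, of x 0] by (simp add: dist_real_def)
  have int: "integrable lborel (\<lambda>x. std_normal_density x * h x)"
    by (rule integrable_std_normal_density_mult_lipschitz[OF h])
  \<comment> \<open>\<open>f\<close> grows at most linearly, so the density beats it.\<close>
  have lim: "((\<lambda>x. f x * std_normal_density x) \<longlongrightarrow> 0) F"
    if "(std_normal_density \<longlongrightarrow> 0) F" "((\<lambda>x. x * std_normal_density x) \<longlongrightarrow> 0) F" for F
  proof (rule Lim_null_comparison)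
    show "\<forall>\<^sub>F x in F. norm (f x * std_normal_density x) \<le>
        \<bar>f 0\<bar> * std_normal_density x + \<bar>x * std_normal_density x\<bar>"
      using mult_right_mono[OF fle normal_density_nonneg[of 0 1]]
      by (intro always_eventually) (auto simp: abs_mult distrib_right)
    show "((\<lambda>x. \<bar>f 0\<bar> * std_normal_density x + \<bar>x * std_normal_density x\<bar>) \<longlongrightarrow> 0) F"
      using tendsto_add[OF tendsto_mult_left[OF that(1), of "\<bar>f 0\<bar>"] tendsto_rabs_zero[OF that(2)]] by simp
  qed
  have hcont: "isCont h x" for x
    using lipschitz_on_continuous_on[OF h] by (simp add: continuous_on_eq_continuous_at)
  have "(LBINT x=-\<infinity>..\<infinity>. std_normal_density x * (h x - c)) = 0 - 0"
  proof (rule interval_integral_FTC_integrable[where F="\<lambda>x. f x * std_normal_density x"])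
    show "((\<lambda>x. f x * std_normal_density x) has_vector_derivative std_normal_density x * (h x - c)) (at x)" for x
      unfolding has_real_derivative_iff_has_vector_derivative[symmetric] eq[symmetric]
      by (rule derivative_eq_intros f refl)+ (simp add: algebra_simps)
    show "isCont (\<lambda>x. std_normal_density x * (h x - c)) x" for x
      by (intro isCont_mult isCont_diff hcont isCont_std_normal_density) auto
    show "set_integrable lborel (einterval (- \<infinity>) \<infinity>) (\<lambda>x. std_normal_density x * (h x - c))"
      using int by (simp add: set_integrable_def einterval_def right_diff_distrib)
  qed (auto simp: ereal_tendsto_simps1 intro!: lim tendsto_std_normal_density_at_bot tendsto_mult_std_normal_density_at_bot
          tendsto_std_normal_density_at_top tendsto_mult_std_normal_density_at_top)
  then have "(\<integral>x. std_normal_density x * (h x - c) \<partial>lborel) = 0"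
    by (simp add: interval_lebesgue_integral_def einterval_def set_lebesgue_integral_def)
  then show ?thesis
    using int by (simp add: right_diff_distrib)
qed

text \<open>The solution is written through the derivative \<open>g\<close> of \<open>h\<close> as
  \<open>- (q w * I w + p w * J w)\<close>: \<open>p\<close> and \<open>q\<close> are the two Mills
  ratios, \<open>I w\<close> integrates \<open>g x * Phi x\<close> up to \<open>w\<close>, and
  \<open>J w\<close> integrates \<open>g x * Phi (- x)\<close> from \<open>w\<close> on. The bounds
  then reduce to relations between \<open>p\<close>, \<open>q\<close> and
  \<open>Psi\<close>.\<close>

lemma stein_solution:
  fixes h g :: "real \<Rightarrow> real"
  assumes h: "\<And>x. (h has_real_derivative g x) (at x)"
    and cont: "\<And>x. isCont g x" and bound: "\<And>x. \<bar>g x\<bar> \<le> 1"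
  obtains f f' f'' :: "real \<Rightarrow> real" where
    "\<And>x. (f has_real_derivative f' x) (at x)"
    "\<And>x. (f' has_real_derivative f'' x) (at x)"
    "\<And>x. \<bar>f' x\<bar> \<le> 1" "\<And>x. \<bar>f'' x\<bar> \<le> 2"
    "\<And>w. f' w - w * f w = h w - (\<integral>x. std_normal_density x * h x \<partial>lborel)"
proof -
  define d where "d = std_normal_density"
  define I where "I = (\<lambda>w. LINT x:{..w}|lborel. g x * Phi x)"
  \<comment> \<open>The upper half-line is reflected, so that the lemmas on lower half-lines
    apply.\<close>
  define J where "J = (\<lambda>w. LINT x:{..-w}|lborel. g (- x) * Phi x)"
  define p where "p = (\<lambda>w. Phi w / d w)"
  define q where "q = (\<lambda>w. Phi (- w) / d w)"
  have d: "d x > 0" for x by (simp add: d_def std_normal_density_pos)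
  have d': "(d has_real_derivative - x * d x) (at x)" for x
    unfolding d_def by (rule has_field_derivative_std_normal_density)
  have P': "(Phi has_real_derivative d x) (at x)" for x
    unfolding d_def by (rule has_field_derivative_Phi)
  have contm: "isCont (\<lambda>x. g (- x)) x" for x
    using isCont_o2[of "-x" uminus g] cont by (intro isCont_o2[of x uminus g]) auto
  note I' = has_field_derivative_LINT_mult_Phi[OF cont bound, folded I_def]
  have J': "(J has_real_derivative - (g w * Phi (- w))) (at w)" for w
    using DERIV_chain2[OF has_field_derivative_LINT_mult_Phi[OF contm bound, of "-w"] DERIV_minus[OF DERIV_ident]]
    by (simp add: J_def)
  have I_le: "\<bar>I w\<bar> \<le> Psi w" for w
    unfolding I_def by (rule abs_LINT_mult_Phi_le[OF cont bound])
  have J_le: "\<bar>J w\<bar> \<le> Psi (- w)" for w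
    unfolding J_def by (rule abs_LINT_mult_Phi_le[OF contm bound])
  have p': "(p has_real_derivative 1 + w * p w) (at w)" for w
    unfolding p_def using d[of w]
    by (auto intro!: derivative_eq_intros d' simp: d_def field_simps power2_eq_square)
  have Pm': "((\<lambda>w. Phi (- w)) has_real_derivative - d w) (at w)" for w
    using DERIV_chain2[OF P'[of "-w"] DERIV_minus[OF DERIV_ident]]
    by (simp add: d_def std_normal_density_minus)
  have q': "(q has_real_derivative - 1 + w * q w) (at w)" for w
    unfolding q_def using d[of w]
    by (auto intro!: derivative_eq_intros Pm' d' simp: field_simps power2_eq_square)
  have Phi_p: "Phi w = d w * p w" and Phi_q: "Phi (- w) = d w * q w" for w
    using d[of w] by (auto simp: p_def q_def)
  have pq: "d w * (p w + q w) = 1" for w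
    using Phi_minus[of w] by (simp add: distrib_left Phi_p[of w] Phi_q)
  have Psi_p: "Psi w = d w * (1 + w * p w)" and Psi_q: "Psi (- w) = d w * (1 - w * q w)" for w
    by (simp add: Psi_def Phi_p[of w] d_def algebra_simps,
        simp add: Psi_def Phi_q d_def std_normal_density_minus algebra_simps)
  have B0: "1 + w * p w \<ge> 0" and A0: "1 - w * q w \<ge> 0" for w
    using Psi_nonneg[of w] Psi_nonneg[of "-w"] d[of w]
    by (auto simp: Psi_p[of w] Psi_q[of w] zero_le_mult_iff)
  have p0: "(1 + w\<^sup>2) * p w + w \<ge> 0" and q0: "(1 + w\<^sup>2) * q w - w \<ge> 0" for w
  proof -
    have "d w * ((1 + w\<^sup>2) * p w + w) \<ge> 0" "d w * ((1 + w\<^sup>2) * q w - w) \<ge> 0"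
      using mills_lower[of w] mills_lower[of "-w"]
      by (simp_all add: Phi_p[of w] Phi_q d_def std_normal_density_minus algebra_simps)
    then show "(1 + w\<^sup>2) * p w + w \<ge> 0" "(1 + w\<^sup>2) * q w - w \<ge> 0"
      using d[of w] by (auto simp: zero_le_mult_iff)
  qed

  \<comment> \<open>The derivative of \<open>I - J\<close> is
    \<open>g w * (Phi w + Phi (- w)) = g w\<close>, so \<open>I - J\<close> equals \<open>h\<close>
    up to a constant, which is identified at the end.\<close>
  have "((\<lambda>w. I w - J w - h w) has_real_derivative 0) (at w)" for w
    by (rule derivative_eq_intros I' J' h refl)+ (simp add: Phi_minus algebra_simps)
  then obtain c where "\<And>w. I w - J w - h w = - c"
    using DERIV_isconst_all[of "\<lambda>w. I w - J w - h w"] by (metis minus_minus)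
  then have IJ: "I w - J w = h w - c" for w by (simp add: algebra_simps)

  define f where "f = (\<lambda>w. - (q w * I w + p w * J w))"
  define f' where "f' = (\<lambda>w. (1 - w * q w) * I w - (1 + w * p w) * J w)"
  define f'' where "f'' = (\<lambda>w. g w - ((1 + w\<^sup>2) * q w - w) * I w - ((1 + w\<^sup>2) * p w + w) * J w)"
  \<comment> \<open>The contributions of the derivatives of \<open>I\<close> and \<open>J\<close>
    cancel: they are \<open>d w * p w * q w * g w\<close> with opposite signs.\<close>
  have f1: "(f has_real_derivative f' w) (at w)" for w
    unfolding f_def f'_def
    by (rule derivative_eq_intros p' q' I' J' refl)+ (simp add: Phi_p[of w] Phi_q algebra_simps)
  have f2: "(f' has_real_derivative f'' w) (at w)" for w
  proof -
    have "(f' has_real_derivative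
        (w - (1 + w\<^sup>2) * q w) * I w + (1 - w * q w) * (g w * Phi w)
        - ((w + (1 + w\<^sup>2) * p w) * J w - (1 + w * p w) * (g w * Phi (- w)))) (at w)"
      unfolding f'_def
      by (rule derivative_eq_intros p' q' I' J' refl)+ (simp add: algebra_simps power2_eq_square)
    \<comment> \<open>The coefficient of \<open>g w\<close> collapses to 1 by
      \<open>pq\<close>.\<close>
    also have "(1 - w * q w) * (g w * Phi w) + (1 + w * p w) * (g w * Phi (- w)) = g w * (d w * (p w + q w))"
      by (simp add: Phi_p[of w] Phi_q algebra_simps)
    then have "(w - (1 + w\<^sup>2) * q w) * I w + (1 - w * q w) * (g w * Phi w)
        - ((w + (1 + w\<^sup>2) * p w) * J w - (1 + w * p w) * (g w * Phi (- w))) = f'' w"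
      unfolding pq f''_def by (simp add: algebra_simps)
    finally show ?thesis .
  qed
  have f'_le: "\<bar>f' w\<bar> \<le> 1" for w
  proof -
    have "\<bar>f' w\<bar> \<le> (1 - w * q w) * Psi w + (1 + w * p w) * Psi (- w)"
      unfolding f'_def using A0[of w] B0[of w]
      by (intro order_trans[OF abs_triangle_ineq4] add_mono)
         (auto simp: abs_mult intro!: mult_mono I_le J_le)
    \<comment> \<open>By \<open>Psi_p\<close> and \<open>Psi_q\<close> each summand equals
      \<open>Psi w * Psi (- w) / d w\<close>.\<close>
    also have "\<dots> = 2 * (Psi w * Psi (- w)) / d w"
      using d[of w] by (simp add: Psi_p[of w] Psi_q[of w] field_simps)
    also have "\<dots> \<le> 1"
      using Psi_mult_Psi_minus_le[of w] d[of w] by (simp add: d_def)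
    finally show ?thesis .
  qed
  have f''_le: "\<bar>f'' w\<bar> \<le> 2" for w
  proof -
    have "\<bar>f'' w\<bar> \<le> \<bar>g w\<bar> + \<bar>((1 + w\<^sup>2) * q w - w) * I w\<bar> + \<bar>((1 + w\<^sup>2) * p w + w) * J w\<bar>"
      unfolding f''_def by linarith
    also have "\<dots> \<le> 1 + ((1 + w\<^sup>2) * q w - w) * Psi w + ((1 + w\<^sup>2) * p w + w) * Psi (- w)"
      using p0[of w] q0[of w]
      by (intro add_mono bound) (auto simp: abs_mult intro!: mult_mono I_le J_le)
    \<comment> \<open>The terms in \<open>p w * q w\<close> cancel and
      \<open>d w * (p w + q w) = 1\<close>, hence the constant 2.\<close>
    also have "\<dots> = 1 + d w * (p w + q w)"
      by (simp add: Psi_p[of w] Psi_q[of w] algebra_simps power2_eq_square)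
    finally show ?thesis by (simp add: pq)
  qed
  have eq: "f' w - w * f w = h w - c" for w
    unfolding IJ[symmetric] f_def f'_def by (simp add: algebra_simps)
  have "c = (\<integral>x. std_normal_density x * h x \<partial>lborel)"
    by (rule stein_operator_expectation_zero[OF f1 f'_le eq lipschitz_onI_DERIV[OF h bound]]) simp
  with that[OF f1 f2 f'_le f''_le] eq show thesis by blast
qed

section \<open>Smoothing of Lipschitz test functions\<close>

text \<open>\<open>k x\<close> is the average of \<open>h\<close> over \<open>[x, x + e]\<close>,
  built from an antiderivative \<open>H\<close>. Its derivative is a difference quotient of
  \<open>h\<close>, and the mean value theorem makes \<open>k x\<close> a value of \<open>h\<close>
  within distance \<open>e\<close> of \<open>x\<close>.\<close>

lemma lipschitz_C1_approximation:
  fixes h :: "real \<Rightarrow> real"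
  assumes lip: "1-lipschitz_on UNIV h" and e: "e > 0"
  obtains k g :: "real \<Rightarrow> real" where
    "\<And>x. (k has_real_derivative g x) (at x)" "\<And>x. isCont g x" "\<And>x. \<bar>g x\<bar> \<le> 1"
    "\<And>x. \<bar>k x - h x\<bar> \<le> e"
proof -
  have hcont: "isCont h x" for x
    using lipschitz_on_continuous_on[OF lip] by (simp add: continuous_on_eq_continuous_at)
  obtain H where H: "\<And>x. (H has_real_derivative h x) (at x)"
    using einterval_antiderivative[of "-\<infinity>" \<infinity> h] hcont
    by (auto simp: has_real_derivative_iff_has_vector_derivative)
  define k where "k = (\<lambda>x. (H (x + e) - H x) / e)"
  define g where "g = (\<lambda>x. (h (x + e) - h x) / e)"
  show thesis
  proof (rule that)
    show "(k has_real_derivative g x) (at x)" for x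
      unfolding k_def g_def using e
      by (auto intro!: derivative_eq_intros DERIV_chain2[OF H] H)
    show "isCont g x" for x
      unfolding g_def using e by (intro continuous_intros isCont_o2[OF _ hcont] hcont) auto
    show "\<bar>g x\<bar> \<le> 1" for x
      using lipschitz_onD[OF lip, of "x + e" x] e by (simp add: g_def dist_real_def field_simps)
    show "\<bar>k x - h x\<bar> \<le> e" for x
    proof -
      obtain z where z: "x < z" "z < x + e" "H (x + e) - H x = (x + e - x) * h z"
        using MVT2[of x "x + e" H h] H e by auto
      then have "k x = h z" using e by (simp add: k_def)
      then show ?thesis using lipschitz_onD[OF lip, of z x] z by (simp add: dist_real_def)
    qed
  qed
qed

subsection \<open>The discrepancy of a standardized variable\<close>

text \<open>This provides an antiderivative of \<open>2 * \<bar>x\<bar>\<close> across the kink; at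
  0 the difference quotient is \<open>\<bar>t\<bar>\<close>.\<close>

lemma has_field_derivative_mult_abs:
  "((\<lambda>t::real. t * \<bar>t\<bar>) has_real_derivative 2 * \<bar>x\<bar>) (at x)"
proof -
  consider "x > 0" | "x < 0" | "x = 0" by linarith
  then show ?thesis
  proof cases
    case 1
    have "((\<lambda>t::real. t * t) has_real_derivative 2 * \<bar>x\<bar>) (at x)"
      using 1 by (auto intro!: derivative_eq_intros)
    then show ?thesis
      by (rule has_field_derivative_transform_within_open[where S="{0<..}"]) (use 1 in auto)
  next
    case 2
    have "((\<lambda>t::real. - (t * t)) has_real_derivative 2 * \<bar>x\<bar>) (at x)"
      using 2 by (auto intro!: derivative_eq_intros)
    then show ?thesis
      by (rule has_field_derivative_transform_within_open[where S="{..<0}"]) (use 2 in auto)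
  next
    case 3
    have "(\<lambda>t::real. \<bar>t\<bar>) \<midarrow>0\<rightarrow> 0" by (intro tendsto_eq_intros) auto
    then have "(\<lambda>t::real. t * \<bar>t\<bar> / t) \<midarrow>0\<rightarrow> 0"
      by (rule Lim_transform_eventually) (auto simp: eventually_at_filter)
    then show ?thesis using 3 by (simp add: DERIV_def)
  qed
qed

text \<open>A pointwise inequality, to be integrated over two independent copies. Both sides are
  symmetric in \<open>x\<close> and \<open>y\<close>, so \<open>y \<le> x\<close> may be assumed;
  then the points move apart from their midpoint and derivatives in the half-distance are
  compared.\<close>

lemma symmetrized_taylor_bound:
  fixes f f' f'' :: "real \<Rightarrow> real"
  assumes f: "\<And>x. (f has_real_derivative f' x) (at x)"
    and f': "\<And>x. (f' has_real_derivative f'' x) (at x)"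
    and f'': "\<And>x. \<bar>f'' x\<bar> \<le> L"
  shows "\<bar>(x - y) * (f x - f y + y * f' x - x * f' y)\<bar> \<le> L / 2 * ((x - y) * (x * \<bar>x\<bar> - y * \<bar>y\<bar>))"
proof -
  have main: "\<bar>f x - f y + y * f' x - x * f' y\<bar> \<le> L / 2 * (x * \<bar>x\<bar> - y * \<bar>y\<bar>)" if "y \<le> x" for x y
  proof -
    define m where "m = (x + y) / 2"
    define r where "r = (x - y) / 2"
    \<comment> \<open>In the derivative of \<open>G\<close> all terms in \<open>f'\<close> cancel
      and only \<open>f''\<close> remains.\<close>
    define G where "G = (\<lambda>s. f (m + s) - f (m - s) + (m - s) * f' (m + s) - (m + s) * f' (m - s))"
    define G' where "G' = (\<lambda>s. (m - s) * f'' (m + s) + (m + s) * f'' (m - s))"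
    define K where "K = (\<lambda>s. L / 2 * ((m + s) * \<bar>m + s\<bar> - (m - s) * \<bar>m - s\<bar>))"
    define K' where "K' = (\<lambda>s. L * (\<bar>m + s\<bar> + \<bar>m - s\<bar>))"
    have G: "(G has_real_derivative G' s) (at s)" for s
      unfolding G_def G'_def
      by (rule derivative_eq_intros DERIV_chain2[OF f] DERIV_chain2[OF f'] refl)+ (simp add: algebra_simps)
    have K: "(K has_real_derivative K' s) (at s)" for s
      unfolding K_def K'_def
      by (rule derivative_eq_intros DERIV_chain2[OF has_field_derivative_mult_abs] refl)+ (simp add: algebra_simps)
    have le: "\<bar>G' s\<bar> \<le> K' s" for s
    proof -
      have "\<bar>G' s\<bar> \<le> \<bar>m - s\<bar> * \<bar>f'' (m + s)\<bar> + \<bar>m + s\<bar> * \<bar>f'' (m - s)\<bar>"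
        unfolding G'_def by (intro order_trans[OF abs_triangle_ineq]) (simp add: abs_mult)
      also have "\<dots> \<le> \<bar>m - s\<bar> * L + \<bar>m + s\<bar> * L"
        by (intro add_mono mult_left_mono f'') auto
      finally show ?thesis by (simp add: K'_def algebra_simps)
    qed
    have r: "0 \<le> r" using that by (simp add: r_def)
    \<comment> \<open>\<open>K - G\<close> and \<open>K + G\<close> are nondecreasing and vanish at
      0, so \<open>K r\<close> bounds \<open>\<bar>G r\<bar>\<close>.\<close>
    have "K 0 - G 0 \<le> K r - G r"
    proof (rule DERIV_nonneg_imp_nondecreasing[OF r])
      show "\<exists>y. ((\<lambda>s. K s - G s) has_real_derivative y) (at s) \<and> 0 \<le> y" for s
        using DERIV_diff[OF K G, of s] le[of s] by (intro exI[of _ "K' s - G' s"]) auto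
    qed
    moreover have "K 0 + G 0 \<le> K r + G r"
    proof (rule DERIV_nonneg_imp_nondecreasing[OF r])
      show "\<exists>y. ((\<lambda>s. K s + G s) has_real_derivative y) (at s) \<and> 0 \<le> y" for s
        using DERIV_add[OF K G, of s] le[of s] by (intro exI[of _ "K' s + G' s"]) auto
    qed
    moreover have "G 0 = 0" "K 0 = 0" by (simp_all add: G_def K_def)
    ultimately have "\<bar>G r\<bar> \<le> K r" by linarith
    moreover have "m + r = x" "m - r = y" by (simp_all add: m_def r_def field_simps)
    ultimately show ?thesis by (simp add: G_def K_def)
  qed
  show ?thesis
  proof (cases "y \<le> x")
    case True
    then show ?thesis
      using mult_left_mono[OF main[OF True], of "x - y"] by (simp add: abs_mult mult.left_commute)
  next
    case False
    then have "y - x \<ge> 0" "x \<le> y" by auto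
    have "\<bar>(x - y) * (f x - f y + y * f' x - x * f' y)\<bar> = (y - x) * \<bar>f y - f x + x * f' y - y * f' x\<bar>"
      using False by (simp add: abs_mult)
    also have "\<dots> \<le> (y - x) * (L / 2 * (y * \<bar>y\<bar> - x * \<bar>x\<bar>))"
      by (intro mult_left_mono main) (use False in auto)
    also have "\<dots> = L / 2 * ((x - y) * (x * \<bar>x\<bar> - y * \<bar>y\<bar>))" by (simp add: field_simps)
    finally show ?thesis .
  qed
qed

text \<open>
  With \<open>Y\<close> an independent copy of \<open>X\<close>, the left-hand side is the absolute value of
  \<open>E (X - Y) (f X - f Y + Y f' X - X f' Y) / 2\<close>.
\<close>
lemma stein_discrepancy_bound:
  fixes M :: "real measure" and f f' f'' :: "real \<Rightarrow> real"
  assumes M: "prob_space M" and sets: "sets M = sets borel"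
    and i3: "integrable M (\<lambda>x. \<bar>x\<bar> ^ 3)"
    and i2: "integrable M (\<lambda>x. x\<^sup>2)"
    and e1: "(\<integral>x. x \<partial>M) = 0" and e2: "(\<integral>x. x\<^sup>2 \<partial>M) = 1"
    and f: "\<And>x. (f has_real_derivative f' x) (at x)"
    and f': "\<And>x. (f' has_real_derivative f'' x) (at x)"
    and bound: "\<And>x. \<bar>f' x\<bar> \<le> C"
    and f'': "\<And>x. \<bar>f'' x\<bar> \<le> L"
  shows "\<bar>(\<integral>x. x * f x - f' x \<partial>M)\<bar> \<le> L / 2 * (\<integral>x. \<bar>x\<bar> ^ 3 \<partial>M)"
proof -
  interpret prob_space M by fact
  note [measurable_cong] = sets
  have [measurable]: "f \<in> borel_measurable borel" "f' \<in> borel_measurable borel"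
    using f f' by (auto intro!: borel_measurable_continuous_onI continuous_at_imp_continuous_on DERIV_isCont)
  have C: "C \<ge> 0" using bound[of 0] by linarith
  have "\<bar>x\<bar> \<le> 1 + x\<^sup>2" for x :: real
    using zero_le_power2[of "\<bar>x\<bar> - 1"] abs_ge_zero[of x] unfolding power2_diff by simp
  then have i1: "integrable M (\<lambda>x. x)"
    by (intro Bochner_Integration.integrable_bound
          [OF Bochner_Integration.integrable_add[OF integrable_const i2, of 1]]) auto
  have i0': "integrable M f'"
    by (rule integrable_const_bound[where B=C]) (use bound in auto)
  have fle: "\<bar>f x\<bar> \<le> \<bar>f 0\<bar> + C * \<bar>x\<bar>" for x
    using field_differentiable_bound[of UNIV f f' C x 0] f bound by (auto simp: abs_if split: if_splits)
  have i0: "integrable M f"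
    by (rule Bochner_Integration.integrable_bound[OF Bochner_Integration.integrable_add
          [OF integrable_const integrable_mult_right[OF integrable_abs[OF i1]], of "\<bar>f 0\<bar>" C]])
       (use fle C in \<open>auto simp: abs_mult\<close>)
  have i1f: "integrable M (\<lambda>x. x * f x)"
  proof (rule Bochner_Integration.integrable_bound[OF Bochner_Integration.integrable_add
          [OF integrable_mult_right[OF integrable_abs[OF i1], of "\<bar>f 0\<bar>"] integrable_mult_right[OF i2, of C]]])
    have "\<bar>x * f x\<bar> \<le> \<bar>f 0\<bar> * \<bar>x\<bar> + C * x\<^sup>2" for x
      using mult_left_mono[OF fle[of x], of "\<bar>x\<bar>"]
      by (simp add: abs_mult distrib_left power2_eq_square mult.left_commute mult.commute[of "\<bar>f 0\<bar>"])
    from order_trans[OF this abs_ge_self]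
    show "AE x in M. norm (x * f x) \<le> norm (\<bar>f 0\<bar> * \<bar>x\<bar> + C * x\<^sup>2)" by simp
  qed simp
  have i1f': "integrable M (\<lambda>x. x * f' x)"
    by (rule Bochner_Integration.integrable_bound[OF integrable_mult_right[OF integrable_abs[OF i1], of C]])
       (use C bound in \<open>auto simp: abs_mult mult.commute[of C] intro!: mult_left_mono\<close>)
  have ia: "integrable M (\<lambda>x. x * \<bar>x\<bar>)"
    by (rule Bochner_Integration.integrable_bound[OF i2]) (auto simp: abs_mult power2_eq_square)
  define m3 where "m3 = (\<integral>x. \<bar>x\<bar> ^ 3 \<partial>M)"
  define D where "D = (\<integral>x. x * f x \<partial>M) - (\<integral>x. f' x \<partial>M)"
  define ma where "ma = (\<integral>x. x * \<bar>x\<bar> \<partial>M)"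
  have ab3: "x * (x * \<bar>x\<bar>) = \<bar>x\<bar> ^ 3" for x :: real
    by (simp add: power3_eq_cube)
  \<comment> \<open>Integrating over \<open>y\<close> uses mean 0 and second moment 1.\<close>
  have Ein: "(\<integral>y. (x - y) * (f x - f y + y * f' x - x * f' y) \<partial>M) =
      x * f x - f' x + (\<integral>y. y * f y \<partial>M) - x\<^sup>2 * (\<integral>y. f' y \<partial>M)
      - x * (\<integral>y. f y \<partial>M) + x * (\<integral>y. y * f' y \<partial>M)"
    and Iin: "integrable M (\<lambda>y. (x - y) * (f x - f y + y * f' x - x * f' y))" for x
  proof -
    have eq: "(x - y) * (f x - f y + y * f' x - x * f' y) =
        x * f x + x * f' x * y - f x * y - f' x * y\<^sup>2 + y * f y - x\<^sup>2 * f' y - x * f y + x * (y * f' y)" for y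
      by (simp add: algebra_simps power2_eq_square)
    show "integrable M (\<lambda>y. (x - y) * (f x - f y + y * f' x - x * f' y))"
      unfolding eq
      by (intro Bochner_Integration.integrable_add Bochner_Integration.integrable_diff
          integrable_mult_right i1 i2 i0 i0' i1f i1f' integrable_const)
    show "(\<integral>y. (x - y) * (f x - f y + y * f' x - x * f' y) \<partial>M) =
      x * f x - f' x + (\<integral>y. y * f y \<partial>M) - x\<^sup>2 * (\<integral>y. f' y \<partial>M)
      - x * (\<integral>y. f y \<partial>M) + x * (\<integral>y. y * f' y \<partial>M)"
      unfolding eq using i1 i2 i0 i0' i1f i1f' by (simp add: e1 e2 prob_space)
  qed
  have Bin: "(\<integral>y. L / 2 * ((x - y) * (x * \<bar>x\<bar> - y * \<bar>y\<bar>)) \<partial>M) = L / 2 * (\<bar>x\<bar> ^ 3 + m3 - x * ma)"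
    and IBin: "integrable M (\<lambda>y. L / 2 * ((x - y) * (x * \<bar>x\<bar> - y * \<bar>y\<bar>)))" for x
  proof -
    have eq: "(x - y) * (x * \<bar>x\<bar> - y * \<bar>y\<bar>) = \<bar>x\<bar> ^ 3 - x * (y * \<bar>y\<bar>) - x * \<bar>x\<bar> * y + \<bar>y\<bar> ^ 3" for y
      unfolding ab3[symmetric] by (simp add: algebra_simps)
    show "integrable M (\<lambda>y. L / 2 * ((x - y) * (x * \<bar>x\<bar> - y * \<bar>y\<bar>)))"
      unfolding eq
      by (intro Bochner_Integration.integrable_add Bochner_Integration.integrable_diff
          integrable_mult_right i1 i3 ia integrable_const)
    show "(\<integral>y. L / 2 * ((x - y) * (x * \<bar>x\<bar> - y * \<bar>y\<bar>)) \<partial>M) = L / 2 * (\<bar>x\<bar> ^ 3 + m3 - x * ma)"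
      unfolding eq using i1 i3 ia by (simp add: e1 prob_space m3_def ma_def)
  qed
  \<comment> \<open>The terms linear in \<open>x\<close> have mean zero; what is left is
    \<open>D\<close> once from each of the two copies.\<close>
  have "\<bar>2 * D\<bar> = \<bar>\<integral>x. (\<integral>y. (x - y) * (f x - f y + y * f' x - x * f' y) \<partial>M) \<partial>M\<bar>"
    unfolding Ein using i1 i2 i0 i0' i1f i1f' by (simp add: e1 e2 prob_space D_def)
  also have "\<dots> \<le> (\<integral>x. \<bar>\<integral>y. (x - y) * (f x - f y + y * f' x - x * f' y) \<partial>M\<bar> \<partial>M)"
    by (rule integral_abs_bound)
  also have "\<dots> \<le> (\<integral>x. (\<integral>y. L / 2 * ((x - y) * (x * \<bar>x\<bar> - y * \<bar>y\<bar>)) \<partial>M) \<partial>M)"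
  proof (rule integral_mono)
    show "integrable M (\<lambda>x. \<bar>\<integral>y. (x - y) * (f x - f y + y * f' x - x * f' y) \<partial>M\<bar>)"
      unfolding Ein
      by (intro integrable_abs Bochner_Integration.integrable_add Bochner_Integration.integrable_diff
          integrable_mult_left i1 i2 i0 i0' i1f i1f' integrable_const)
    show "integrable M (\<lambda>x. \<integral>y. L / 2 * ((x - y) * (x * \<bar>x\<bar> - y * \<bar>y\<bar>)) \<partial>M)"
      unfolding Bin
      by (intro integrable_mult_right Bochner_Integration.integrable_add Bochner_Integration.integrable_diff
          integrable_mult_left i1 i3 integrable_const)
    show "\<bar>\<integral>y. (x - y) * (f x - f y + y * f' x - x * f' y) \<partial>M\<bar> \<le> (\<integral>y. L / 2 * ((x - y) * (x * \<bar>x\<bar> - y * \<bar>y\<bar>)) \<partial>M)" for x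
      by (rule order_trans[OF integral_abs_bound]
            integral_mono integrable_abs Iin IBin symmetrized_taylor_bound f f' f'')+
  qed
  \<comment> \<open>The term with \<open>ma\<close> has mean zero, and each copy contributes
    \<open>m3\<close>.\<close>
  also have "\<dots> = L / 2 * (2 * m3)"
    unfolding Bin using i1 i3 by (simp add: e1 prob_space m3_def)
  finally have "\<bar>D\<bar> \<le> L / 2 * m3" by (simp add: abs_mult)
  moreover have "(\<integral>x. x * f x - f' x \<partial>M) = D"
    using i1f i0' by (simp add: D_def)
  ultimately show ?thesis by (simp add: m3_def)
qed

subsection \<open>Moments of quadratic forms\<close>

text \<open>The pointwise inequality between arithmetic and geometric mean, applied to
  \<open>t * f x\<close> and \<open>g x\<close>, is integrated and then optimized over
  \<open>t\<close>.\<close>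

lemma
  fixes f g :: "'a \<Rightarrow> real"
  assumes [measurable]: "f \<in> borel_measurable M" "g \<in> borel_measurable M"
    and f: "integrable M (\<lambda>x. (f x)\<^sup>2)" and g: "integrable M (\<lambda>x. (g x)\<^sup>2)"
  shows integrable_mult_square_integrable: "integrable M (\<lambda>x. f x * g x)"
    and LINT_abs_mult_le: "(\<integral>x. \<bar>f x * g x\<bar> \<partial>M) \<le> sqrt (\<integral>x. (f x)\<^sup>2 \<partial>M) * sqrt (\<integral>x. (g x)\<^sup>2 \<partial>M)"
proof -
  have amgm: "2 * \<bar>a * b\<bar> \<le> a\<^sup>2 + b\<^sup>2" for a b :: real
    using zero_le_power2[of "\<bar>a\<bar> - \<bar>b\<bar>"] unfolding power2_diff by (simp add: abs_mult)
  show int: "integrable M (\<lambda>x. f x * g x)"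
  proof (rule Bochner_Integration.integrable_bound[OF Bochner_Integration.integrable_add[OF f g]])
    show "AE x in M. norm (f x * g x) \<le> norm ((f x)\<^sup>2 + (g x)\<^sup>2)"
      using amgm[of "f x" "g x" for x] abs_ge_zero[of "f x * g x" for x]
      by (intro AE_I2) (smt (verit) real_norm_def zero_le_power2)
  qed measurable
  define F where "F = (\<integral>x. (f x)\<^sup>2 \<partial>M)"
  define G where "G = (\<integral>x. (g x)\<^sup>2 \<partial>M)"
  define A where "A = (\<integral>x. \<bar>f x * g x\<bar> \<partial>M)"
  have nn: "F \<ge> 0" "G \<ge> 0" "A \<ge> 0" by (auto simp: F_def G_def A_def)
  have quad: "2 * t * A \<le> t\<^sup>2 * F + G" for t
  proof (cases "t \<ge> 0")
    case True
    have "(\<integral>x. 2 * t * \<bar>f x * g x\<bar> \<partial>M) \<le> (\<integral>x. t\<^sup>2 * (f x)\<^sup>2 + (g x)\<^sup>2 \<partial>M)"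
    proof (intro integral_mono Bochner_Integration.integrable_add integrable_mult_right integrable_abs int f g)
      show "2 * t * \<bar>f x * g x\<bar> \<le> t\<^sup>2 * (f x)\<^sup>2 + (g x)\<^sup>2" for x
        using amgm[of "t * f x" "g x"] True by (simp add: abs_mult power_mult_distrib)
    qed
    then show ?thesis using f g int by (simp add: F_def G_def A_def)
  next
    case False
    then have "2 * t * A \<le> 0" using nn by (simp add: mult_nonpos_nonneg)
    also have "0 \<le> t\<^sup>2 * F + G" using nn by simp
    finally show ?thesis .
  qed
  have "A\<^sup>2 \<le> F * G"
  proof (cases "F = 0")
    case True
    have "A = 0"
    proof (rule ccontr)
      assume "A \<noteq> 0"
      \<comment> \<open>This \<open>t\<close> is chosen to push the left side of \<open>quad\<close>
        above \<open>G\<close>.\<close>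
      then have "2 * ((G + 1) / (2 * A)) * A = G + 1" by simp
      then show False using quad[of "(G + 1) / (2 * A)"] True by simp
    qed
    then show ?thesis using nn by simp
  next
    case False
    then have "F > 0" using nn by simp
    \<comment> \<open>\<open>A / F\<close> is the optimal \<open>t\<close>.\<close>
    have "F * (2 * (A / F) * A) \<le> F * ((A / F)\<^sup>2 * F + G)"
      using nn by (intro mult_left_mono quad) auto
    then show ?thesis using \<open>F > 0\<close> by (simp add: power2_eq_square field_simps)
  qed
  then have "A \<le> sqrt (F * G)" by (rule real_le_rsqrt)
  then show "(\<integral>x. \<bar>f x * g x\<bar> \<partial>M) \<le> sqrt (\<integral>x. (f x)\<^sup>2 \<partial>M) * sqrt (\<integral>x. (g x)\<^sup>2 \<partial>M)"
    by (simp add: A_def F_def G_def real_sqrt_mult)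
qed

section \<open>Mixed moments of independent standardized variables\<close>

text \<open>Integrability of the fourth power is stated separately: without it the expectation in
  \<open>fourth\<close> would default to 0.\<close>

locale indep_standardized = prob_space M for M :: "'a measure" +
  fixes X :: "'i \<Rightarrow> 'a \<Rightarrow> real" and I :: "'i set" and m4 :: real
  assumes finite_I: "finite I"
    and indep: "indep_vars (\<lambda>_. borel) X I"
    and integrable_fourth: "k \<in> I \<Longrightarrow> integrable M (\<lambda>\<omega>. X k \<omega> ^ 4)"
    and mean: "k \<in> I \<Longrightarrow> expectation (X k) = 0"
    and variance: "k \<in> I \<Longrightarrow> expectation (\<lambda>\<omega>. (X k \<omega>)\<^sup>2) = 1"
    and fourth: "k \<in> I \<Longrightarrow> expectation (\<lambda>\<omega>. X k \<omega> ^ 4) = m4"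
begin

lemma measurable_X: "k \<in> I \<Longrightarrow> X k \<in> borel_measurable M"
  using indep by (auto simp: indep_vars_def)

lemma integrable_power:
  assumes "k \<in> I" "p \<le> 4" shows "integrable M (\<lambda>\<omega>. X k \<omega> ^ p)"
proof (rule Bochner_Integration.integrable_bound[OF Bochner_Integration.integrable_add
      [OF integrable_const[of 1] integrable_fourth[OF assms(1)]]])
  show "(\<lambda>\<omega>. X k \<omega> ^ p) \<in> borel_measurable M" using measurable_X[OF assms(1)] by measurable
  have "\<bar>x ^ p\<bar> \<le> 1 + x ^ 4" for x :: real
  proof (cases "\<bar>x\<bar> \<le> 1")
    case True
    then have "\<bar>x ^ p\<bar> \<le> 1" by (simp add: power_abs power_le_one)
    then show ?thesis by (simp add: add_increasing2)
  next
    case False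
    then have "\<bar>x\<bar> ^ p \<le> \<bar>x\<bar> ^ 4" using assms(2) by (intro power_increasing) auto
    then show ?thesis by (simp add: power_abs)
  qed
  then show "AE \<omega> in M. norm (X k \<omega> ^ p) \<le> norm (1 + X k \<omega> ^ 4)"
    by (auto simp: power_abs intro!: AE_I2)
qed

lemma
  assumes "\<And>k. k \<in> I \<Longrightarrow> p k \<le> 4"
  shows integrable_prod_power: "integrable M (\<lambda>\<omega>. \<Prod>k\<in>I. X k \<omega> ^ p k)"
    and expectation_prod_power:
      "expectation (\<lambda>\<omega>. \<Prod>k\<in>I. X k \<omega> ^ p k) = (\<Prod>k\<in>I. expectation (\<lambda>\<omega>. X k \<omega> ^ p k))"
proof -
  have ind: "indep_vars (\<lambda>_. borel) (\<lambda>k \<omega>. X k \<omega> ^ p k) I"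
    by (rule indep_vars_compose2[OF indep]) auto
  show "integrable M (\<lambda>\<omega>. \<Prod>k\<in>I. X k \<omega> ^ p k)"
    by (rule indep_vars_integrable[OF finite_I ind]) (auto intro: integrable_power assms)
  show "expectation (\<lambda>\<omega>. \<Prod>k\<in>I. X k \<omega> ^ p k) = (\<Prod>k\<in>I. expectation (\<lambda>\<omega>. X k \<omega> ^ p k))"
    by (rule indep_vars_lebesgue_integral[OF finite_I ind]) (auto intro: integrable_power assms)
qed

text \<open>Written this way, a monomial in the variables becomes one product over \<open>I\<close>
  in which the exponents add up, ready for \<open>expectation_prod_power\<close>.\<close>

lemma prod_power_of_bool: "i \<in> I \<Longrightarrow> (\<Prod>m\<in>I. X m \<omega> ^ of_bool (m = i)) = X i \<omega>"
proof -
  assume "i \<in> I"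
  have "(\<Prod>m\<in>I. X m \<omega> ^ of_bool (m = i)) = (\<Prod>m\<in>I. if m = i then X m \<omega> else 1)"
    by (intro prod.cong) auto
  also have "\<dots> = X i \<omega>" using \<open>i \<in> I\<close> finite_I by (simp add: prod.delta)
  finally show ?thesis .
qed

text \<open>The exponent \<open>p m\<close> counts the occurrences of \<open>m\<close> among the
  four indices. An index occurring once contributes a zero mean; otherwise there are two pairs or
  one quadruple. When all indices agree the three pairings already contribute 3, hence the
  correction \<open>m4 - 3\<close>.\<close>

lemma
  assumes "i \<in> I" "j \<in> I" "k \<in> I" "l \<in> I"
  shows integrable_mult4: "integrable M (\<lambda>\<omega>. X i \<omega> * X j \<omega> * (X k \<omega> * X l \<omega>))"
    and expectation_mult4: "expectation (\<lambda>\<omega>. X i \<omega> * X j \<omega> * (X k \<omega> * X l \<omega>)) =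
      of_bool (i = j \<and> k = l) + of_bool (i = k \<and> j = l) + of_bool (i = l \<and> j = k)
      + (m4 - 3) * of_bool (i = j \<and> j = k \<and> k = l)" (is "_ = ?rhs")
proof -
  define p :: "'i \<Rightarrow> nat" where
    "p = (\<lambda>m. of_bool (m = i) + of_bool (m = j) + (of_bool (m = k) + of_bool (m = l)))"
  have eq: "X i \<omega> * X j \<omega> * (X k \<omega> * X l \<omega>) = (\<Prod>m\<in>I. X m \<omega> ^ p m)" for \<omega>
    unfolding p_def power_add prod.distrib using assms by (simp only: prod_power_of_bool)
  have p4: "p m \<le> 4" for m by (simp add: p_def)
  show "integrable M (\<lambda>\<omega>. X i \<omega> * X j \<omega> * (X k \<omega> * X l \<omega>))"
    unfolding eq by (rule integrable_prod_power[OF p4])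
  define e where "e = (\<lambda>m. expectation (\<lambda>\<omega>. X m \<omega> ^ p m))"
  have "expectation (\<lambda>\<omega>. X i \<omega> * X j \<omega> * (X k \<omega> * X l \<omega>)) = (\<Prod>m\<in>I. e m)"
    unfolding eq e_def by (rule expectation_prod_power[OF p4])
  also have "\<dots> = ?rhs"
  proof (cases "\<exists>m\<in>{i, j, k, l}. p m = 1")
    case True
    then obtain m where m: "m \<in> {i, j, k, l}" "p m = 1" by blast
    have "m \<in> I" using m(1) assms by auto
    then have "e m = 0" using m(2) by (simp add: e_def mean)
    then have "(\<Prod>m\<in>I. e m) = 0" using \<open>m \<in> I\<close> finite_I by (auto simp: prod_zero_iff)
    moreover have "?rhs = 0"
    proof -
      have p1: "of_bool (m = i) + of_bool (m = j) + (of_bool (m = k) + of_bool (m = l)) = (1::nat)"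
        using m(2) by (simp add: p_def)
      consider "m = i" | "m = j" | "m = k" | "m = l" using m(1) by blast
      then show ?thesis
      proof cases
        case 1
        then have "m \<noteq> j \<and> m \<noteq> k \<and> m \<noteq> l"
          using p1 by (cases "m = j"; cases "m = k"; cases "m = l"; simp)
        with 1 show ?thesis by auto
      next
        case 2
        then have "m \<noteq> i \<and> m \<noteq> k \<and> m \<noteq> l"
          using p1 by (cases "m = i"; cases "m = k"; cases "m = l"; simp)
        with 2 show ?thesis by auto
      next
        case 3
        then have "m \<noteq> i \<and> m \<noteq> j \<and> m \<noteq> l"
          using p1 by (cases "m = i"; cases "m = j"; cases "m = l"; simp)
        with 3 show ?thesis by auto
      next
        case 4
        then have "m \<noteq> i \<and> m \<noteq> j \<and> m \<noteq> k"
          using p1 by (cases "m = i"; cases "m = j"; cases "m = k"; simp)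
        with 4 show ?thesis by auto
      qed
    qed
    ultimately show ?thesis by (simp only:)
  next
    case False
    have e: "e m = (if p m = 2 then 1 else if p m = 4 then m4 else e m)" if "m \<in> I" for m
      using that by (simp add: e_def variance fourth)
    have "(\<Prod>m\<in>I. e m) = (\<Prod>m\<in>{i, j, k, l}. e m)"
      using assms finite_I
      by (intro prod.mono_neutral_right) (auto simp: e_def p_def prob_space)
    also have "\<dots> = (\<Prod>m\<in>{i, j, k, l}. (if p m = 2 then 1 else if p m = 4 then m4 else e m))"
      using assms by (intro prod.cong e) auto
    also have "\<dots> = ?rhs"
    proof -
      \<comment> \<open>Without an isolated index, either all four coincide or they split into two
        distinct pairs in one of three ways.\<close>
      have "p i \<noteq> 1" "p j \<noteq> 1" "p k \<noteq> 1" "p l \<noteq> 1" using False by auto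
      then consider "i = j" "k = l" "i = k" | "i = j" "k = l" "i \<noteq> k" | "i = k" "j = l" "i \<noteq> j"
        | "i = l" "j = k" "i \<noteq> j"
        unfolding p_def
        by (cases "i = j"; cases "i = k"; cases "i = l"; cases "j = k"; cases "j = l"; cases "k = l"; simp)
      then show ?thesis
        by cases (simp_all add: p_def insert_commute)
    qed
    finally show ?thesis .
  qed
  finally show "expectation (\<lambda>\<omega>. X i \<omega> * X j \<omega> * (X k \<omega> * X l \<omega>)) = ?rhs" .
qed

lemma
  assumes "i \<in> I" "j \<in> I"
  shows integrable_mult2: "integrable M (\<lambda>\<omega>. X i \<omega> * X j \<omega>)"
    and expectation_mult2: "expectation (\<lambda>\<omega>. X i \<omega> * X j \<omega>) = of_bool (i = j)"
proof -
  define p :: "'i \<Rightarrow> nat" where "p = (\<lambda>m. of_bool (m = i) + of_bool (m = j))"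
  have eq: "X i \<omega> * X j \<omega> = (\<Prod>m\<in>I. X m \<omega> ^ p m)" for \<omega>
    unfolding p_def power_add prod.distrib using assms by (simp only: prod_power_of_bool)
  have p4: "p m \<le> 4" for m by (simp add: p_def)
  show "integrable M (\<lambda>\<omega>. X i \<omega> * X j \<omega>)"
    unfolding eq by (rule integrable_prod_power[OF p4])
  show "expectation (\<lambda>\<omega>. X i \<omega> * X j \<omega>) = of_bool (i = j)"
  proof (cases "i = j")
    case True
    then show ?thesis using variance[OF assms(1)] by (simp add: power2_eq_square)
  next
    case False
    have "expectation (\<lambda>\<omega>. X i \<omega> * X j \<omega>) = (\<Prod>m\<in>I. expectation (\<lambda>\<omega>. X m \<omega> ^ p m))"
      unfolding eq by (rule expectation_prod_power[OF p4])
    also have "\<dots> = 0"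
      using assms(1) finite_I False mean[OF assms(1)] by (auto simp: p_def intro!: bexI[of _ i])
    finally show ?thesis using False by simp
  qed
qed

section \<open>First and second moments of quadratic forms\<close>

definition quad :: "('i \<Rightarrow> 'i \<Rightarrow> real) \<Rightarrow> 'a \<Rightarrow> real" where
  "quad b \<omega> = (\<Sum>i\<in>I. \<Sum>j\<in>I. b i j * (X i \<omega> * X j \<omega>))"

lemma measurable_quad [measurable]: "quad b \<in> borel_measurable M"
  unfolding quad_def[abs_def] using measurable_X by measurable

lemma
  shows integrable_quad: "integrable M (quad b)"
    and expectation_quad: "expectation (quad b) = (\<Sum>i\<in>I. b i i)"
proof -
  show "integrable M (quad b)"
    unfolding quad_def[abs_def]
    by (intro Bochner_Integration.integrable_sum integrable_mult_right integrable_mult2)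
  have "expectation (quad b) = (\<Sum>i\<in>I. \<Sum>j\<in>I. b i j * of_bool (i = j))"
    unfolding quad_def[abs_def]
    by (simp add: Bochner_Integration.integral_sum Bochner_Integration.integrable_sum integrable_mult2
        expectation_mult2)
  also have "\<dots> = (\<Sum>i\<in>I. b i i)"
    using finite_I by (intro sum.cong) (auto simp: of_bool_def if_distrib sum.delta cong: if_cong)
  finally show "expectation (quad b) = (\<Sum>i\<in>I. b i i)" .
qed

lemma quad_mult_quad:
  "quad b \<omega> * quad c \<omega> =
    (\<Sum>i\<in>I. \<Sum>j\<in>I. \<Sum>k\<in>I. \<Sum>l\<in>I. b i j * c k l * (X i \<omega> * X j \<omega> * (X k \<omega> * X l \<omega>)))"
  unfolding quad_def[of b] sum_distrib_right unfolding quad_def[of c] sum_distrib_left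
  by (intro sum.cong refl) (simp add: mult_ac)

lemma integrable_quad_mult_quad: "integrable M (\<lambda>\<omega>. quad b \<omega> * quad c \<omega>)"
  unfolding quad_mult_quad
  by (intro Bochner_Integration.integrable_sum integrable_mult_right integrable_mult4)

lemma integrable_quad_square: "integrable M (\<lambda>\<omega>. (quad b \<omega>)\<^sup>2)"
  unfolding power2_eq_square by (rule integrable_quad_mult_quad)

text \<open>The pairing \<open>i = j\<close>, \<open>k = l\<close> gives the squared trace; the
  other two pairings each give the sum of squared entries, one of them through symmetry; the
  correction for equal indices gives the diagonal term.\<close>

lemma expectation_quad_square:
  assumes sym: "\<And>i j. i \<in> I \<Longrightarrow> j \<in> I \<Longrightarrow> b i j = b j i"
  shows "expectation (\<lambda>\<omega>. (quad b \<omega>)\<^sup>2) =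
    (\<Sum>i\<in>I. b i i)\<^sup>2 + 2 * (\<Sum>i\<in>I. \<Sum>j\<in>I. (b i j)\<^sup>2) + (m4 - 3) * (\<Sum>i\<in>I. (b i i)\<^sup>2)"
proof -
  have d: "(\<Sum>j\<in>I. f j * of_bool (j = i)) = f i" "(\<Sum>j\<in>I. f j * of_bool (i = j)) = f i"
    if "i \<in> I" for f :: "'i \<Rightarrow> real" and i
    using that finite_I by (auto simp: of_bool_def if_distrib sum.delta cong: if_cong)
  have "expectation (\<lambda>\<omega>. (quad b \<omega>)\<^sup>2) = (\<Sum>i\<in>I. \<Sum>j\<in>I. \<Sum>k\<in>I. \<Sum>l\<in>I. b i j * b k l *
      expectation (\<lambda>\<omega>. X i \<omega> * X j \<omega> * (X k \<omega> * X l \<omega>)))"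
    unfolding power2_eq_square quad_mult_quad
    by (simp add: Bochner_Integration.integral_sum Bochner_Integration.integrable_sum integrable_mult4)
  also have "\<dots> = (\<Sum>i\<in>I. \<Sum>j\<in>I. \<Sum>k\<in>I. \<Sum>l\<in>I.
        b i j * b k l * of_bool (i = j) * of_bool (k = l)
      + b i j * b k l * of_bool (i = k) * of_bool (j = l)
      + b i j * b k l * of_bool (j = k) * of_bool (i = l)
      + (m4 - 3) * (b i j * b k l * of_bool (i = j) * of_bool (j = k) * of_bool (k = l)))"
    by (intro sum.cong refl) (auto simp: expectation_mult4 distrib_left)
  also have "\<dots> = (\<Sum>i\<in>I. \<Sum>j\<in>I. \<Sum>k\<in>I. b i j * b k k * of_bool (i = j))
      + (\<Sum>i\<in>I. \<Sum>j\<in>I. \<Sum>k\<in>I. b i j * b k j * of_bool (i = k))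
      + (\<Sum>i\<in>I. \<Sum>j\<in>I. \<Sum>k\<in>I. b i j * b k i * of_bool (j = k))
      + (m4 - 3) * (\<Sum>i\<in>I. \<Sum>j\<in>I. \<Sum>k\<in>I. b i j * b k k * of_bool (i = j) * of_bool (j = k))"
  proof -
    have "(\<Sum>l\<in>I.
        b i j * b k l * of_bool (i = j) * of_bool (k = l)
      + b i j * b k l * of_bool (i = k) * of_bool (j = l)
      + b i j * b k l * of_bool (j = k) * of_bool (i = l)
      + (m4 - 3) * (b i j * b k l * of_bool (i = j) * of_bool (j = k) * of_bool (k = l)))
      = b i j * b k k * of_bool (i = j) + b i j * b k j * of_bool (i = k) + b i j * b k i * of_bool (j = k)
        + (m4 - 3) * (b i j * b k k * of_bool (i = j) * of_bool (j = k))"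
      if "i \<in> I" "j \<in> I" "k \<in> I" for i j k
      unfolding sum.distrib sum_distrib_left[symmetric] using that by (simp only: d)
    then show ?thesis by (simp add: sum.distrib sum_distrib_left)
  qed
  also have "(\<Sum>i\<in>I. \<Sum>j\<in>I. \<Sum>k\<in>I. b i j * b k k * of_bool (i = j)) = (\<Sum>i\<in>I. b i i)\<^sup>2"
    unfolding power2_eq_square sum_product
    by (rule sum.cong[OF refl], subst sum.swap, intro sum.cong refl) (simp only: d)
  also have "(\<Sum>i\<in>I. \<Sum>j\<in>I. \<Sum>k\<in>I. b i j * b k j * of_bool (i = k)) = (\<Sum>i\<in>I. \<Sum>j\<in>I. (b i j)\<^sup>2)"
    by (intro sum.cong refl) (simp only: d power2_eq_square)
  also have "(\<Sum>i\<in>I. \<Sum>j\<in>I. \<Sum>k\<in>I. b i j * b k i * of_bool (j = k)) = (\<Sum>i\<in>I. \<Sum>j\<in>I. (b i j)\<^sup>2)"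
    by (intro sum.cong refl) (simp only: d, simp add: sym power2_eq_square)
  also have "(\<Sum>i\<in>I. \<Sum>j\<in>I. \<Sum>k\<in>I. b i j * b k k * of_bool (i = j) * of_bool (j = k)) = (\<Sum>i\<in>I. (b i i)\<^sup>2)"
    by (intro sum.cong refl) (simp only: d power2_eq_square cong: sum.cong)
  finally show ?thesis by simp
qed

end

subsection \<open>Normal approximation of quadratic forms\<close>

text \<open>\<^const>\<open>prob_space.indep_var\<close> forces both variables to have the same value type, so
  independence of variables of different types is stated through their joint distribution.\<close>
lemma (in prob_space) indep_var_compose_joint_distr:
  assumes ind: "indep_var S A S' B"
    and [measurable]: "f \<in> S \<rightarrow>\<^sub>M T" "g \<in> S' \<rightarrow>\<^sub>M T'"
  shows "distr M T (\<lambda>\<omega>. f (A \<omega>)) \<Otimes>\<^sub>M distr M T' (\<lambda>\<omega>. g (B \<omega>)) =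
    distr M (T \<Otimes>\<^sub>M T') (\<lambda>\<omega>. (f (A \<omega>), g (B \<omega>)))"
proof -
  have [measurable]: "A \<in> M \<rightarrow>\<^sub>M S" "B \<in> M \<rightarrow>\<^sub>M S'"
    using ind by (auto dest: indep_var_rv1 indep_var_rv2)
  interpret B: prob_space "distr M S' B" by (rule prob_space_distr) simp
  interpret gB: prob_space "distr (distr M S' B) T' g" by (rule B.prob_space_distr) simp
  have "distr M T (\<lambda>\<omega>. f (A \<omega>)) \<Otimes>\<^sub>M distr M T' (\<lambda>\<omega>. g (B \<omega>)) =
      distr (distr M S A) T f \<Otimes>\<^sub>M distr (distr M S' B) T' g"
    by (simp add: distr_distr comp_def)
  also have "\<dots> = distr (distr M S A \<Otimes>\<^sub>M distr M S' B) (T \<Otimes>\<^sub>M T') (\<lambda>(x, y). (f x, g y))"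
    by (rule pair_measure_distr) (simp_all add: gB.sigma_finite_measure_axioms)
  also have "distr M S A \<Otimes>\<^sub>M distr M S' B = distr M (S \<Otimes>\<^sub>M S') (\<lambda>\<omega>. (A \<omega>, B \<omega>))"
    using ind by (simp add: indep_var_distribution_eq)
  finally show ?thesis by (simp add: distr_distr comp_def)
qed

text \<open>For fixed values \<open>t\<close>, \<open>v\<close> of \<open>T\<close>,
  \<open>V\<close>, \<open>stein_discrepancy_bound\<close> is applied to
  \<open>t * f (v + 2 * (u * t))\<close> as a function of \<open>u\<close>. Its second derivative is
  at most \<open>8 * \<bar>t\<bar> ^ 3\<close>, and half of this gives the constant 4.\<close>

lemma (in prob_space) stein_leave_one_out_bound:
  fixes U T V :: "'a \<Rightarrow> real" and f f' f'' :: "real \<Rightarrow> real"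
  assumes mU [measurable]: "U \<in> borel_measurable M"
    and mT [measurable]: "T \<in> borel_measurable M" and mV [measurable]: "V \<in> borel_measurable M"
    and ind: "distr M borel U \<Otimes>\<^sub>M distr M (borel \<Otimes>\<^sub>M borel) (\<lambda>\<omega>. (T \<omega>, V \<omega>)) =
      distr M (borel \<Otimes>\<^sub>M (borel \<Otimes>\<^sub>M borel)) (\<lambda>\<omega>. (U \<omega>, (T \<omega>, V \<omega>)))"
    and U2: "integrable M (\<lambda>\<omega>. (U \<omega>)\<^sup>2)" and U3: "integrable M (\<lambda>\<omega>. \<bar>U \<omega>\<bar> ^ 3)"
    and T3: "integrable M (\<lambda>\<omega>. \<bar>T \<omega>\<bar> ^ 3)"
    and EU: "expectation U = 0" and EU2: "expectation (\<lambda>\<omega>. (U \<omega>)\<^sup>2) = 1"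
    and f: "\<And>x. (f has_real_derivative f' x) (at x)"
    and f': "\<And>x. (f' has_real_derivative f'' x) (at x)"
    and f'_le: "\<And>x. \<bar>f' x\<bar> \<le> 1" and f''_le: "\<And>x. \<bar>f'' x\<bar> \<le> 2"
    and int: "integrable M (\<lambda>\<omega>. U \<omega> * T \<omega> * f (V \<omega> + 2 * (U \<omega> * T \<omega>))
        - 2 * (T \<omega>)\<^sup>2 * f' (V \<omega> + 2 * (U \<omega> * T \<omega>)))"
  shows "\<bar>expectation (\<lambda>\<omega>. U \<omega> * T \<omega> * f (V \<omega> + 2 * (U \<omega> * T \<omega>))
        - 2 * (T \<omega>)\<^sup>2 * f' (V \<omega> + 2 * (U \<omega> * T \<omega>)))\<bar>
      \<le> 4 * expectation (\<lambda>\<omega>. \<bar>U \<omega>\<bar> ^ 3) * expectation (\<lambda>\<omega>. \<bar>T \<omega>\<bar> ^ 3)"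
proof -
  have [measurable]: "f \<in> borel_measurable borel" "f' \<in> borel_measurable borel"
    using f f' by (auto intro!: borel_measurable_continuous_onI continuous_at_imp_continuous_on DERIV_isCont)
  define \<mu> where "\<mu> = distr M borel U"
  define \<nu> where "\<nu> = distr M (borel \<Otimes>\<^sub>M borel) (\<lambda>\<omega>. (T \<omega>, V \<omega>))"
  define m3 where "m3 = expectation (\<lambda>\<omega>. \<bar>U \<omega>\<bar> ^ 3)"
  interpret \<mu>: prob_space \<mu> unfolding \<mu>_def by (rule prob_space_distr) simp
  interpret \<nu>: prob_space \<nu> unfolding \<nu>_def by (rule prob_space_distr) simp
  interpret P: pair_sigma_finite \<mu> \<nu> ..
  have [measurable_cong]: "sets \<mu> = sets borel" "sets \<nu> = sets (borel \<Otimes>\<^sub>M borel)"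
    by (simp_all add: \<mu>_def \<nu>_def)
  define G where "G = (\<lambda>u p. u * fst p * f (snd p + 2 * (u * fst p))
      - 2 * (fst p)\<^sup>2 * f' (snd p + 2 * (u * fst p)))"
  have joint: "\<mu> \<Otimes>\<^sub>M \<nu> = distr M (borel \<Otimes>\<^sub>M (borel \<Otimes>\<^sub>M borel)) (\<lambda>\<omega>. (U \<omega>, (T \<omega>, V \<omega>)))"
    using ind by (simp add: \<mu>_def \<nu>_def)
  have mG [measurable]: "case_prod G \<in> borel_measurable (borel \<Otimes>\<^sub>M (borel \<Otimes>\<^sub>M borel))"
    unfolding G_def by measurable
  have G_eq: "U \<omega> * T \<omega> * f (V \<omega> + 2 * (U \<omega> * T \<omega>)) - 2 * (T \<omega>)\<^sup>2 * f' (V \<omega> + 2 * (U \<omega> * T \<omega>))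
      = (case (U \<omega>, (T \<omega>, V \<omega>)) of (u, p) \<Rightarrow> G u p)" for \<omega>
    by (simp add: G_def)
  have intG: "integrable (\<mu> \<Otimes>\<^sub>M \<nu>) (case_prod G)"
    unfolding joint using int unfolding G_eq by (subst integrable_distr_eq) auto
  have m3: "(\<integral>x. \<bar>x\<bar> ^ 3 \<partial>\<mu>) = m3"
    unfolding \<mu>_def m3_def by (rule integral_distr) auto
  have inner: "\<bar>\<integral>u. G u p \<partial>\<mu>\<bar> \<le> 4 * m3 * \<bar>fst p\<bar> ^ 3" for p
  proof -
    obtain t v where p: "p = (t, v)" by (cases p)
    have "\<bar>(\<integral>u. u * (t * f (v + 2 * (u * t))) - 2 * t\<^sup>2 * f' (v + 2 * (u * t)) \<partial>\<mu>)\<bar>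
        \<le> 8 * \<bar>t\<bar> ^ 3 / 2 * (\<integral>x. \<bar>x\<bar> ^ 3 \<partial>\<mu>)"
    proof (rule stein_discrepancy_bound[where f''="\<lambda>u. 4 * t ^ 3 * f'' (v + 2 * (u * t))" and C="2 * t\<^sup>2"])
      show "prob_space \<mu>" by unfold_locales
      show "sets \<mu> = sets borel" by (simp add: \<mu>_def)
      show "integrable \<mu> (\<lambda>x. \<bar>x\<bar> ^ 3)" "integrable \<mu> (\<lambda>x. x\<^sup>2)"
        unfolding \<mu>_def using U2 U3 by (auto simp: integrable_distr_eq)
      show "(\<integral>x. x \<partial>\<mu>) = 0" "(\<integral>x. x\<^sup>2 \<partial>\<mu>) = 1"
        unfolding \<mu>_def using EU EU2 by (auto simp: integral_distr)
      show "((\<lambda>u. t * f (v + 2 * (u * t))) has_real_derivative 2 * t\<^sup>2 * f' (v + 2 * (x * t))) (at x)" for x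
        by (rule derivative_eq_intros DERIV_chain2[OF f] refl)+ (simp add: power2_eq_square)
      show "((\<lambda>u. 2 * t\<^sup>2 * f' (v + 2 * (u * t))) has_real_derivative 4 * t ^ 3 * f'' (v + 2 * (x * t))) (at x)" for x
        by (rule derivative_eq_intros DERIV_chain2[OF f'] refl)+ (simp add: power2_eq_square power3_eq_cube)
      show "\<bar>2 * t\<^sup>2 * f' (v + 2 * (x * t))\<bar> \<le> 2 * t\<^sup>2" for x
        using mult_left_mono[OF f'_le[of "v + 2 * (x * t)"], of "2 * t\<^sup>2"] by (simp add: abs_mult)
      show "\<bar>4 * t ^ 3 * f'' (v + 2 * (x * t))\<bar> \<le> 8 * \<bar>t\<bar> ^ 3" for x
        using mult_left_mono[OF f''_le[of "v + 2 * (x * t)"], of "4 * \<bar>t\<bar> ^ 3"] by (simp add: abs_mult power_abs)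
    qed
    then show ?thesis by (simp add: p G_def m3 mult_ac)
  qed
  have T3': "integrable \<nu> (\<lambda>p. 4 * m3 * \<bar>fst p\<bar> ^ 3)"
    unfolding \<nu>_def using T3 by (subst integrable_distr_eq) auto
  have "\<bar>expectation (\<lambda>\<omega>. U \<omega> * T \<omega> * f (V \<omega> + 2 * (U \<omega> * T \<omega>))
        - 2 * (T \<omega>)\<^sup>2 * f' (V \<omega> + 2 * (U \<omega> * T \<omega>)))\<bar> = \<bar>integral\<^sup>L (\<mu> \<Otimes>\<^sub>M \<nu>) (case_prod G)\<bar>"
    unfolding G_eq joint by (subst integral_distr) auto
  \<comment> \<open>By independence and Fubini, \<open>u\<close> is integrated first.\<close>
  also have "\<dots> = \<bar>\<integral>p. (\<integral>u. G u p \<partial>\<mu>) \<partial>\<nu>\<bar>"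
    using P.integral_snd[OF intG] by simp
  also have "\<dots> \<le> (\<integral>p. \<bar>\<integral>u. G u p \<partial>\<mu>\<bar> \<partial>\<nu>)" by (rule integral_abs_bound)
  also have "\<dots> \<le> (\<integral>p. 4 * m3 * \<bar>fst p\<bar> ^ 3 \<partial>\<nu>)"
    by (intro integral_mono integrable_abs P.integrable_snd intG T3' inner)
  also have "\<dots> = 4 * m3 * expectation (\<lambda>\<omega>. \<bar>T \<omega>\<bar> ^ 3)"
    unfolding \<nu>_def by (subst integral_distr) auto
  finally show ?thesis by (simp add: m3_def)
qed

context indep_standardized
begin

section \<open>Moments of linear forms\<close>

definition lin :: "('i \<Rightarrow> real) \<Rightarrow> 'a \<Rightarrow> real" where
  "lin c \<omega> = (\<Sum>l\<in>I. c l * X l \<omega>)"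

lemma measurable_lin [measurable]: "lin c \<in> borel_measurable M"
  unfolding lin_def[abs_def] using measurable_X by measurable

text \<open>The square of a linear form is a quadratic form of rank one, so its moments follow from
  those of \<open>quad\<close>.\<close>

lemma lin_square: "(lin c \<omega>)\<^sup>2 = quad (\<lambda>i j. c i * c j) \<omega>"
  unfolding lin_def quad_def power2_eq_square sum_product
  by (intro sum.cong refl) (simp add: mult_ac)

lemma X_mult_lin: "k \<in> I \<Longrightarrow> X k \<omega> * lin c \<omega> = quad (\<lambda>i j. of_bool (i = k) * c j) \<omega>"
proof -
  assume k: "k \<in> I"
  have "quad (\<lambda>i j. of_bool (i = k) * c j) \<omega> = (\<Sum>i\<in>I. if i = k then X i \<omega> * lin c \<omega> else 0)"
    unfolding quad_def lin_def sum_distrib_left by (intro sum.cong refl) (auto simp: mult_ac)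
  then show ?thesis using k finite_I by (simp add: sum.delta)
qed

lemma quad_eq_sum_lin: "quad a \<omega> = (\<Sum>k\<in>I. X k \<omega> * lin (a k) \<omega>)"
  unfolding quad_def lin_def sum_distrib_left by (intro sum.cong refl) (simp add: mult_ac)

lemma integrable_lin_square: "integrable M (\<lambda>\<omega>. (lin c \<omega>)\<^sup>2)"
  unfolding lin_square by (rule integrable_quad)

lemma expectation_lin_square: "expectation (\<lambda>\<omega>. (lin c \<omega>)\<^sup>2) = (\<Sum>l\<in>I. (c l)\<^sup>2)"
  unfolding lin_square by (simp add: expectation_quad power2_eq_square)

lemma integrable_lin_fourth: "integrable M (\<lambda>\<omega>. ((lin c \<omega>)\<^sup>2)\<^sup>2)"
  unfolding lin_square by (rule integrable_quad_square)

lemma m4_nonneg: "I \<noteq> {} \<Longrightarrow> 0 \<le> m4"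
proof -
  assume "I \<noteq> {}"
  then obtain k where "k \<in> I" by blast
  then have "m4 = expectation (\<lambda>\<omega>. X k \<omega> ^ 4)" by (simp add: fourth)
  also have "\<dots> \<ge> 0" by (rule Bochner_Integration.integral_nonneg) simp
  finally show ?thesis .
qed

text \<open>The rank-one matrix has trace \<open>s\<close>, sum of squared entries
  \<open>s\<^sup>2\<close> and sum of squared diagonal entries \<open>q\<close>. In
  \<open>(m4 - 3) * q\<close> the negative part is dropped and \<open>q\<close> is bounded by
  \<open>s\<^sup>2\<close>.\<close>

lemma expectation_lin_fourth_le:
  assumes "I \<noteq> {}"
  shows "expectation (\<lambda>\<omega>. ((lin c \<omega>)\<^sup>2)\<^sup>2) \<le> (3 + m4) * (\<Sum>l\<in>I. (c l)\<^sup>2)\<^sup>2"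
proof -
  define s where "s = (\<Sum>l\<in>I. (c l)\<^sup>2)"
  define q where "q = (\<Sum>l\<in>I. ((c l)\<^sup>2)\<^sup>2)"
  have q0: "0 \<le> q" by (auto simp: q_def intro: sum_nonneg)
  have qs: "q \<le> s\<^sup>2"
  proof -
    have "q = (\<Sum>l\<in>I. (c l)\<^sup>2 * (c l)\<^sup>2)" by (simp add: q_def power2_eq_square)
    also have "\<dots> \<le> (\<Sum>l\<in>I. (c l)\<^sup>2 * s)"
      unfolding s_def using finite_I by (intro sum_mono mult_left_mono member_le_sum) auto
    also have "\<dots> = s\<^sup>2" by (simp add: s_def power2_eq_square sum_distrib_right)
    finally show ?thesis .
  qed
  have "expectation (\<lambda>\<omega>. ((lin c \<omega>)\<^sup>2)\<^sup>2) = s\<^sup>2 + 2 * s\<^sup>2 + (m4 - 3) * q"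
    unfolding lin_square
    by (subst expectation_quad_square)
       (simp_all add: s_def q_def power2_eq_square sum_product mult_ac)
  also have "\<dots> \<le> 3 * s\<^sup>2 + m4 * s\<^sup>2"
    using mult_left_mono[OF qs m4_nonneg[OF assms]] q0 by (simp add: left_diff_distrib)
  finally show ?thesis by (simp add: s_def algebra_simps)
qed

text \<open>Cauchy-Schwarz interpolates the third absolute moment between the second and the
  fourth.\<close>

lemma
  assumes "I \<noteq> {}"
  shows integrable_lin_cube: "integrable M (\<lambda>\<omega>. \<bar>lin c \<omega>\<bar> ^ 3)"
    and expectation_lin_cube_le: "expectation (\<lambda>\<omega>. \<bar>lin c \<omega>\<bar> ^ 3) \<le>
      sqrt (3 + m4) * (sqrt (\<Sum>l\<in>I. (c l)\<^sup>2) * (\<Sum>l\<in>I. (c l)\<^sup>2))"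
proof -
  have eq: "\<bar>x\<bar> ^ 3 = \<bar>x * x\<^sup>2\<bar>" for x :: real
    by (simp add: abs_mult power3_eq_cube power2_eq_square)
  have s0: "0 \<le> (\<Sum>l\<in>I. (c l)\<^sup>2)" by (simp add: sum_nonneg)
  show "integrable M (\<lambda>\<omega>. \<bar>lin c \<omega>\<bar> ^ 3)"
    unfolding eq
    by (intro integrable_abs integrable_mult_square_integrable integrable_lin_square integrable_lin_fourth)
       measurable
  have "expectation (\<lambda>\<omega>. \<bar>lin c \<omega>\<bar> ^ 3) \<le>
      sqrt (expectation (\<lambda>\<omega>. (lin c \<omega>)\<^sup>2)) * sqrt (expectation (\<lambda>\<omega>. ((lin c \<omega>)\<^sup>2)\<^sup>2))"
    unfolding eq
    by (intro LINT_abs_mult_le integrable_lin_square integrable_lin_fourth) measurable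
  also have "\<dots> \<le> sqrt (\<Sum>l\<in>I. (c l)\<^sup>2) * sqrt ((3 + m4) * (\<Sum>l\<in>I. (c l)\<^sup>2)\<^sup>2)"
    unfolding expectation_lin_square
    by (intro mult_left_mono real_sqrt_le_mono expectation_lin_fourth_le assms) (simp add: s0)
  also have "\<dots> = sqrt (3 + m4) * (sqrt (\<Sum>l\<in>I. (c l)\<^sup>2) * (\<Sum>l\<in>I. (c l)\<^sup>2))"
    using s0 by (simp add: real_sqrt_mult)
  finally show "expectation (\<lambda>\<omega>. \<bar>lin c \<omega>\<bar> ^ 3) \<le>
      sqrt (3 + m4) * (sqrt (\<Sum>l\<in>I. (c l)\<^sup>2) * (\<Sum>l\<in>I. (c l)\<^sup>2))" .
qed

lemma
  assumes k: "k \<in> I"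
  shows integrable_X_cube: "integrable M (\<lambda>\<omega>. \<bar>X k \<omega>\<bar> ^ 3)"
    and expectation_X_cube_le: "expectation (\<lambda>\<omega>. \<bar>X k \<omega>\<bar> ^ 3) \<le> sqrt m4"
proof -
  have eq: "\<bar>x\<bar> ^ 3 = \<bar>x * x\<^sup>2\<bar>" for x :: real
    by (simp add: abs_mult power3_eq_cube power2_eq_square)
  have int: "integrable M (\<lambda>\<omega>. (X k \<omega>)\<^sup>2)" "integrable M (\<lambda>\<omega>. ((X k \<omega>)\<^sup>2)\<^sup>2)"
    using integrable_power[OF k, of 2] integrable_power[OF k, of 4] by auto
  note [measurable] = measurable_X[OF k]
  show "integrable M (\<lambda>\<omega>. \<bar>X k \<omega>\<bar> ^ 3)"
    unfolding eq by (intro integrable_abs integrable_mult_square_integrable int) measurable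
  have "expectation (\<lambda>\<omega>. \<bar>X k \<omega>\<bar> ^ 3) \<le>
      sqrt (expectation (\<lambda>\<omega>. (X k \<omega>)\<^sup>2)) * sqrt (expectation (\<lambda>\<omega>. ((X k \<omega>)\<^sup>2)\<^sup>2))"
    unfolding eq by (intro LINT_abs_mult_le int) measurable
  then show "expectation (\<lambda>\<omega>. \<bar>X k \<omega>\<bar> ^ 3) \<le> sqrt m4"
    using k by (simp add: variance fourth)
qed

text \<open>The form with row and column \<open>k\<close> deleted: it does not involve
  \<open>X k\<close>.\<close>

definition quad_without :: "'i \<Rightarrow> ('i \<Rightarrow> 'i \<Rightarrow> real) \<Rightarrow> 'a \<Rightarrow> real" where
  "quad_without k a \<omega> = (\<Sum>i\<in>I - {k}. \<Sum>j\<in>I - {k}. a i j * (X i \<omega> * X j \<omega>))"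

text \<open>Row \<open>k\<close> and column \<open>k\<close> contribute equally by symmetry, hence
  the factor 2.\<close>

lemma quad_split:
  assumes k: "k \<in> I" and sym: "\<And>i j. i \<in> I \<Longrightarrow> j \<in> I \<Longrightarrow> a i j = a j i" and diag: "a k k = 0"
  shows "quad a \<omega> = quad_without k a \<omega> + 2 * (X k \<omega> * lin (a k) \<omega>)"
proof -
  have rem: "(\<Sum>i\<in>I. g i) = g k + (\<Sum>i\<in>I - {k}. g i)" for g :: "'i \<Rightarrow> real"
    by (rule sum.remove[OF finite_I k])
  have "(\<Sum>i\<in>I - {k}. a i k * (X i \<omega> * X k \<omega>)) = (\<Sum>i\<in>I - {k}. a k i * (X k \<omega> * X i \<omega>))"
    using k by (intro sum.cong refl) (auto simp: sym[of _ k] mult_ac)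
  then show ?thesis
    unfolding quad_def quad_without_def lin_def
    by (simp add: rem sum.distrib diag sum_distrib_left mult_ac)
qed

lemma measurable_quad_without [measurable]: "quad_without k a \<in> borel_measurable M"
  unfolding quad_without_def[abs_def] using measurable_X by measurable

text \<open>Since \<open>a k k = 0\<close>, \<open>lin (a k)\<close> also avoids \<open>X k\<close>,
  so the pair is a measurable function \<open>g\<close> of the variables indexed by
  \<open>I - {k}\<close>.\<close>

lemma joint_distr_quad_without:
  assumes k: "k \<in> I" and diag: "a k k = 0"
  shows "distr M borel (X k) \<Otimes>\<^sub>M distr M (borel \<Otimes>\<^sub>M borel) (\<lambda>\<omega>. (lin (a k) \<omega>, quad_without k a \<omega>)) =
    distr M (borel \<Otimes>\<^sub>M (borel \<Otimes>\<^sub>M borel)) (\<lambda>\<omega>. (X k \<omega>, (lin (a k) \<omega>, quad_without k a \<omega>)))"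
proof -
  define g where "g = (\<lambda>x :: 'i \<Rightarrow> real.
    (\<Sum>l\<in>I - {k}. a k l * x l, \<Sum>i\<in>I - {k}. \<Sum>j\<in>I - {k}. a i j * (x i * x j)))"
  have g: "g (restrict (\<lambda>i. X i \<omega>) (I - {k})) = (lin (a k) \<omega>, quad_without k a \<omega>)" for \<omega>
    by (auto simp: g_def lin_def quad_without_def sum.remove[OF finite_I k] diag intro!: sum.cong)
  have "g \<in> PiM (I - {k}) (\<lambda>_. borel) \<rightarrow>\<^sub>M borel \<Otimes>\<^sub>M borel"
    unfolding g_def by measurable
  moreover have "(\<lambda>x. x k) \<in> PiM {k} (\<lambda>_. borel) \<rightarrow>\<^sub>M (borel :: real measure)" by measurable
  ultimately show ?thesis
    using indep_var_compose_joint_distr[OF indep_var_restrict[OF indep, of "{k}" "I - {k}"], of "\<lambda>x. x k" borel g] k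
    by (simp add: g)
qed

section \<open>The bound for a finite fourth moment\<close>

theorem quad_normal_approximation:
  fixes a :: "'i \<Rightarrow> 'i \<Rightarrow> real" and h :: "real \<Rightarrow> real"
  assumes sym: "\<And>i j. i \<in> I \<Longrightarrow> j \<in> I \<Longrightarrow> a i j = a j i" and diag: "\<And>k. k \<in> I \<Longrightarrow> a k k = 0"
    and var: "expectation (\<lambda>\<omega>. (quad a \<omega>)\<^sup>2) = 1" and h: "1-lipschitz_on UNIV h"
  shows "\<bar>expectation (\<lambda>\<omega>. h (quad a \<omega>)) - (\<integral>x. std_normal_density x * h x \<partial>lborel)\<bar> \<le>
    2 * sqrt (m4 * (\<Sum>l\<in>I. (\<Sum>k\<in>I. (a k l)\<^sup>2)\<^sup>2) + 2 * (\<Sum>l\<in>I. \<Sum>p\<in>I. (\<Sum>k\<in>I. a k l * a k p)\<^sup>2))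
    + 4 * sqrt ((3 * m4 + m4\<^sup>2) * (\<Sum>k\<in>I. (\<Sum>l\<in>I. (a k l)\<^sup>2)\<^sup>2))" (is "?lhs \<le> ?rhs")
proof -
  define s where "s = (\<lambda>k. \<Sum>l\<in>I. (a k l)\<^sup>2)"
  define S where "S = (\<Sum>k\<in>I. (s k)\<^sup>2)"
  define b where "b = (\<lambda>l p. \<Sum>k\<in>I. a k l * a k p)"
  define H where "H = (\<Sum>l\<in>I. \<Sum>p\<in>I. (b l p)\<^sup>2)"
  have s0: "0 \<le> s k" for k by (simp add: s_def sum_nonneg)
  have S0: "0 \<le> S" by (simp add: S_def sum_nonneg)
  have col: "(\<Sum>k\<in>I. (a k l)\<^sup>2) = s l" if "l \<in> I" for l
    unfolding s_def using that by (intro sum.cong refl) (simp add: sym[of _ l])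
  have rhs: "?rhs = 2 * sqrt (m4 * S + 2 * H) + 4 * sqrt ((3 * m4 + m4\<^sup>2) * S)"
  proof -
    have "(\<Sum>l\<in>I. (\<Sum>k\<in>I. (a k l)\<^sup>2)\<^sup>2) = S" by (simp add: S_def col cong: sum.cong)
    moreover have "(\<Sum>k\<in>I. (\<Sum>l\<in>I. (a k l)\<^sup>2)\<^sup>2) = S" by (simp add: S_def s_def)
    ultimately show ?thesis by (simp only: H_def b_def)
  qed
  have b_diag: "b l l = s l" if "l \<in> I" for l
    using col[OF that] by (simp add: b_def power2_eq_square)
  \<comment> \<open>With zero diagonal, the second moment of \<open>quad a\<close> is twice the sum
    of all squared entries.\<close>
  have sum_s: "(\<Sum>k\<in>I. s k) = 1 / 2"
    using var expectation_quad_square[of a, OF sym] diag by (simp add: s_def)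
  then have ne: "I \<noteq> {}" by auto
  have m4: "0 \<le> m4" by (rule m4_nonneg[OF ne])
  define Y where "Y = (\<lambda>\<omega>. \<Sum>k\<in>I. (lin (a k) \<omega>)\<^sup>2)"
  \<comment> \<open>The matrix \<open>b\<close> is the transpose of \<open>a\<close> times
    \<open>a\<close>, which by symmetry is the square of \<open>a\<close>.\<close>
  have Y: "Y \<omega> = quad b \<omega>" for \<omega>
  proof -
    have "Y \<omega> = (\<Sum>k\<in>I. \<Sum>i\<in>I. \<Sum>j\<in>I. a k i * a k j * (X i \<omega> * X j \<omega>))"
      by (simp add: Y_def lin_square quad_def)
    also have "\<dots> = (\<Sum>i\<in>I. \<Sum>k\<in>I. \<Sum>j\<in>I. a k i * a k j * (X i \<omega> * X j \<omega>))"
      by (rule sum.swap)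
    also have "\<dots> = (\<Sum>i\<in>I. \<Sum>j\<in>I. \<Sum>k\<in>I. a k i * a k j * (X i \<omega> * X j \<omega>))"
      by (intro sum.cong refl sum.swap)
    finally show ?thesis by (simp add: quad_def b_def sum_distrib_right)
  qed
  have intY: "integrable M Y" and intY2: "integrable M (\<lambda>\<omega>. (Y \<omega>)\<^sup>2)"
    unfolding Y[abs_def] by (rule integrable_quad integrable_quad_square)+
  have EY: "expectation Y = 1 / 2"
    unfolding Y[abs_def] using sum_s by (simp add: expectation_quad b_diag)
  have EY2: "expectation (\<lambda>\<omega>. (Y \<omega>)\<^sup>2) = 1 / 4 + 2 * H + (m4 - 3) * S"
  proof -
    have "b i j = b j i" for i j by (simp add: b_def mult.commute)
    then have "expectation (\<lambda>\<omega>. (Y \<omega>)\<^sup>2) = (\<Sum>i\<in>I. s i)\<^sup>2 + 2 * H + (m4 - 3) * S"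
      unfolding Y by (subst expectation_quad_square) (simp_all add: b_diag H_def S_def cong: sum.cong)
    then show ?thesis unfolding sum_s by (simp add: power2_eq_square)
  qed
  have Y_dev: "expectation (\<lambda>\<omega>. \<bar>1 - 2 * Y \<omega>\<bar>) \<le> 2 * sqrt (m4 * S + 2 * H)"
  proof -
    have sq: "(1 - 2 * Y \<omega>)\<^sup>2 = 1 - 4 * Y \<omega> + 4 * (Y \<omega>)\<^sup>2" for \<omega>
      by (simp add: power2_eq_square algebra_simps)
    have int: "integrable M (\<lambda>\<omega>. (1 - 2 * Y \<omega>)\<^sup>2)"
      unfolding sq using intY intY2 by simp
    have "expectation (\<lambda>\<omega>. \<bar>(1 - 2 * Y \<omega>) * 1\<bar>) \<le>
        sqrt (expectation (\<lambda>\<omega>. (1 - 2 * Y \<omega>)\<^sup>2)) * sqrt (expectation (\<lambda>\<omega>. 1\<^sup>2))"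
      using intY int by (intro LINT_abs_mult_le) auto
    also have "expectation (\<lambda>\<omega>. (1 - 2 * Y \<omega>)\<^sup>2) = 4 * (2 * H + (m4 - 3) * S)"
      unfolding sq using intY intY2 by (simp add: EY EY2 prob_space)
    \<comment> \<open>Here the nonpositive contribution of \<open>- 3 * S\<close> is
      dropped.\<close>
    also have "sqrt (4 * (2 * H + (m4 - 3) * S)) * sqrt (expectation (\<lambda>\<omega>. 1\<^sup>2)) \<le> sqrt (4 * (m4 * S + 2 * H))"
      using S0 by (simp add: prob_space algebra_simps)
    also have "\<dots> = 2 * sqrt (m4 * S + 2 * H)" by (simp only: real_sqrt_mult) simp
    finally show ?thesis by simp
  qed

  have smooth: "\<bar>expectation (\<lambda>\<omega>. h (quad a \<omega>)) - (\<integral>x. std_normal_density x * h x \<partial>lborel)\<bar> \<le> ?rhs"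
    if h: "\<And>x. (h has_real_derivative g x) (at x)" and g: "\<And>x. isCont g x" "\<And>x. \<bar>g x\<bar> \<le> 1"
    for h g
  proof -
    obtain f f' f'' where
      f: "\<And>x. (f has_real_derivative f' x) (at x)" and f': "\<And>x. (f' has_real_derivative f'' x) (at x)"
      and f'_le: "\<And>x. \<bar>f' x\<bar> \<le> 1" and f''_le: "\<And>x. \<bar>f'' x\<bar> \<le> 2"
      and eq: "\<And>w. f' w - w * f w = h w - (\<integral>x. std_normal_density x * h x \<partial>lborel)"
      by (rule stein_solution[OF h g], rule that)
    have [measurable]: "f \<in> borel_measurable borel" "f' \<in> borel_measurable borel"
      using f f' by (auto intro!: borel_measurable_continuous_onI continuous_at_imp_continuous_on DERIV_isCont)
    define W where "W = quad a"
    have [measurable]: "W \<in> borel_measurable M" by (simp add: W_def)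
    have [measurable]: "Y \<in> borel_measurable M" using intY by simp
    have W2: "integrable M (\<lambda>\<omega>. (W \<omega>)\<^sup>2)" unfolding W_def by (rule integrable_quad_square)
    \<comment> \<open>Linear growth of \<open>f\<close> puts \<open>f (W \<omega>)\<close> into L2,
      so that its product with the square-integrable \<open>X k * lin (a k)\<close> is
      integrable.\<close>
    have fW2: "integrable M (\<lambda>\<omega>. (f (W \<omega>))\<^sup>2)"
    proof (rule Bochner_Integration.integrable_bound[OF Bochner_Integration.integrable_add
          [OF integrable_const integrable_mult_right[OF W2], of "2 * (f 0)\<^sup>2" 2]])
      have "(f w)\<^sup>2 \<le> 2 * (f 0)\<^sup>2 + 2 * w\<^sup>2" for w
      proof -
        have "\<bar>f w\<bar> \<le> \<bar>f 0\<bar> + \<bar>w\<bar>"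
          using lipschitz_onD[OF lipschitz_onI_DERIV[OF f f'_le], of w 0] by (simp add: dist_real_def)
        then have "\<bar>f w\<bar>\<^sup>2 \<le> (\<bar>f 0\<bar> + \<bar>w\<bar>)\<^sup>2" by (intro power_mono) auto
        also have "\<dots> \<le> 2 * (f 0)\<^sup>2 + 2 * w\<^sup>2"
          using zero_le_power2[of "\<bar>f 0\<bar> - \<bar>w\<bar>"] by (simp add: power2_sum power2_diff)
        finally show ?thesis by simp
      qed
      then show "AE \<omega> in M. norm ((f (W \<omega>))\<^sup>2) \<le> norm (2 * (f 0)\<^sup>2 + 2 * (W \<omega>)\<^sup>2)" by simp
    qed measurable
    define D where "D = (\<lambda>k \<omega>. X k \<omega> * lin (a k) \<omega> * f (W \<omega>) - 2 * (lin (a k) \<omega>)\<^sup>2 * f' (W \<omega>))"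
    have intD: "integrable M (D k)" if k: "k \<in> I" for k
      unfolding D_def
    proof (rule Bochner_Integration.integrable_diff)
      note [measurable] = measurable_X[OF k]
      show "integrable M (\<lambda>\<omega>. X k \<omega> * lin (a k) \<omega> * f (W \<omega>))"
      proof (rule integrable_mult_square_integrable[OF _ _ _ fW2])
        show "integrable M (\<lambda>\<omega>. (X k \<omega> * lin (a k) \<omega>)\<^sup>2)"
          unfolding X_mult_lin[OF k] by (rule integrable_quad_square)
      qed measurable
      show "integrable M (\<lambda>\<omega>. 2 * (lin (a k) \<omega>)\<^sup>2 * f' (W \<omega>))"
      proof (rule Bochner_Integration.integrable_bound[OF integrable_mult_right[OF integrable_lin_square[of "a k"], of 2]])
        show "AE \<omega> in M. norm (2 * (lin (a k) \<omega>)\<^sup>2 * f' (W \<omega>)) \<le> norm (2 * (lin (a k) \<omega>)\<^sup>2)"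
          using f'_le by (auto simp: abs_mult intro!: mult_left_le)
      qed measurable
    qed
    have D_le: "\<bar>expectation (D k)\<bar> \<le> 4 * sqrt m4 * (sqrt (3 + m4) * (sqrt (s k) * s k))" if k: "k \<in> I" for k
    proof -
      have split: "W \<omega> = quad_without k a \<omega> + 2 * (X k \<omega> * lin (a k) \<omega>)" for \<omega>
        unfolding W_def by (rule quad_split) (use k sym diag in auto)
      have "\<bar>expectation (D k)\<bar> \<le> 4 * expectation (\<lambda>\<omega>. \<bar>X k \<omega>\<bar> ^ 3) * expectation (\<lambda>\<omega>. \<bar>lin (a k) \<omega>\<bar> ^ 3)"
        using intD[OF k] k unfolding D_def split
        by (intro stein_leave_one_out_bound[OF measurable_X[OF k] measurable_lin measurable_quad_without
              joint_distr_quad_without[of k a, OF k diag[OF k]] _ _ _ _ _ f f' f'_le f''_le])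
           (auto intro: integrable_X_cube integrable_lin_cube ne integrable_power mean variance)
      also have "\<dots> \<le> 4 * sqrt m4 * (sqrt (3 + m4) * (sqrt (s k) * s k))"
        unfolding s_def
        by (intro mult_mono expectation_X_cube_le[OF k] expectation_lin_cube_le[OF ne]) (auto simp: m4)
      finally show ?thesis .
    qed
    \<comment> \<open>Cauchy-Schwarz with \<open>sum_s\<close>; the factor
      \<open>sqrt (1 / 2)\<close> is rounded up to 1.\<close>
    have sum_s32: "(\<Sum>k\<in>I. sqrt (s k) * s k) \<le> sqrt S"
    proof -
      have "(\<Sum>k\<in>I. sqrt (s k) * s k) = (\<Sum>k\<in>I. \<bar>sqrt (s k)\<bar> * \<bar>s k\<bar>)" using s0 by simp
      also have "\<dots> \<le> L2_set (\<lambda>k. sqrt (s k)) I * L2_set s I" by (rule L2_set_mult_ineq)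
      also have "\<dots> = sqrt (1 / 2) * sqrt S" using s0 by (simp add: L2_set_def S_def sum_s)
      also have "\<dots> \<le> 1 * sqrt S" by (intro mult_right_mono) (auto simp: S0)
      finally show ?thesis by simp
    qed
    \<comment> \<open>The Stein equation at \<open>W\<close>, with \<open>W\<close> expanded as the
      sum of \<open>X k * lin (a k)\<close>: it separates the fluctuation of \<open>Y\<close> from
      the leave-one-out errors.\<close>
    have dec: "h (W \<omega>) - (\<integral>x. std_normal_density x * h x \<partial>lborel) = (1 - 2 * Y \<omega>) * f' (W \<omega>) - (\<Sum>k\<in>I. D k \<omega>)" for \<omega>
    proof -
      have "(\<Sum>k\<in>I. D k \<omega>) = W \<omega> * f (W \<omega>) - 2 * Y \<omega> * f' (W \<omega>)"
        unfolding D_def sum_subtractf sum_distrib_right[symmetric] sum_distrib_left[symmetric]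
        by (simp add: W_def Y_def quad_eq_sum_lin[of a, symmetric])
      then show ?thesis unfolding eq[symmetric] by (simp add: algebra_simps)
    qed
    have intYf: "integrable M (\<lambda>\<omega>. (1 - 2 * Y \<omega>) * f' (W \<omega>))"
    proof (rule Bochner_Integration.integrable_bound[of _ "\<lambda>\<omega>. 1 - 2 * Y \<omega>"])
      show "AE \<omega> in M. norm ((1 - 2 * Y \<omega>) * f' (W \<omega>)) \<le> norm (1 - 2 * Y \<omega>)"
        using f'_le by (auto simp: abs_mult intro!: mult_left_le)
    qed (use intY in auto)
    have inth: "integrable M (\<lambda>\<omega>. h (W \<omega>))"
    proof -
      have "integrable M (\<lambda>\<omega>. (1 - 2 * Y \<omega>) * f' (W \<omega>) - (\<Sum>k\<in>I. D k \<omega>) + (\<integral>x. std_normal_density x * h x \<partial>lborel))"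
        using intYf intD by simp
      then show ?thesis unfolding dec[symmetric] by simp
    qed
    have "expectation (\<lambda>\<omega>. h (W \<omega>)) - (\<integral>x. std_normal_density x * h x \<partial>lborel)
        = expectation (\<lambda>\<omega>. h (W \<omega>) - (\<integral>x. std_normal_density x * h x \<partial>lborel))"
      using inth by (simp add: prob_space)
    also have "\<dots> = expectation (\<lambda>\<omega>. (1 - 2 * Y \<omega>) * f' (W \<omega>)) - (\<Sum>k\<in>I. expectation (D k))"
      unfolding dec using intYf intD by (simp add: Bochner_Integration.integral_sum)
    finally have "\<bar>expectation (\<lambda>\<omega>. h (W \<omega>)) - (\<integral>x. std_normal_density x * h x \<partial>lborel)\<bar>
        \<le> \<bar>expectation (\<lambda>\<omega>. (1 - 2 * Y \<omega>) * f' (W \<omega>))\<bar> + \<bar>\<Sum>k\<in>I. expectation (D k)\<bar>"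
      by (simp add: abs_triangle_ineq4)
    also have "\<bar>expectation (\<lambda>\<omega>. (1 - 2 * Y \<omega>) * f' (W \<omega>))\<bar> \<le> 2 * sqrt (m4 * S + 2 * H)"
    proof -
      have "\<bar>expectation (\<lambda>\<omega>. (1 - 2 * Y \<omega>) * f' (W \<omega>))\<bar> \<le> expectation (\<lambda>\<omega>. \<bar>(1 - 2 * Y \<omega>) * f' (W \<omega>)\<bar>)"
        by (rule integral_abs_bound)
      also have "\<dots> \<le> expectation (\<lambda>\<omega>. \<bar>1 - 2 * Y \<omega>\<bar>)"
        using intYf intY f'_le
        by (intro integral_mono integrable_abs) (auto simp: abs_mult intro!: mult_left_le)
      finally show ?thesis using Y_dev by linarith
    qed
    also have "\<bar>\<Sum>k\<in>I. expectation (D k)\<bar> \<le> 4 * sqrt ((3 * m4 + m4\<^sup>2) * S)"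
    proof -
      have "\<bar>\<Sum>k\<in>I. expectation (D k)\<bar> \<le> (\<Sum>k\<in>I. 4 * sqrt m4 * (sqrt (3 + m4) * (sqrt (s k) * s k)))"
        by (intro order_trans[OF sum_abs] sum_mono D_le)
      also have "\<dots> = 4 * sqrt m4 * sqrt (3 + m4) * (\<Sum>k\<in>I. sqrt (s k) * s k)"
        by (simp add: sum_distrib_left mult_ac)
      also have "\<dots> \<le> 4 * sqrt m4 * sqrt (3 + m4) * sqrt S"
        by (intro mult_left_mono sum_s32) (auto simp: m4)
      also have "\<dots> = 4 * sqrt ((m4 * (3 + m4)) * S)" by (simp add: real_sqrt_mult)
      finally show ?thesis by (simp add: algebra_simps power2_eq_square)
    qed
    finally show ?thesis unfolding rhs W_def by simp
  qed

  \<comment> \<open>Replacing \<open>h\<close> by a smooth function uniformly within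
    \<open>e / 2\<close> costs \<open>e / 2\<close> in each of the two expectations.\<close>
  have "?lhs \<le> ?rhs + e" if e: "e > 0" for e
  proof -
    obtain k g where k: "\<And>x. (k has_real_derivative g x) (at x)" and g: "\<And>x. isCont g x" "\<And>x. \<bar>g x\<bar> \<le> 1"
      and kh: "\<And>x. \<bar>k x - h x\<bar> \<le> e / 2"
      using lipschitz_C1_approximation[OF h, of "e / 2"] e by auto
    have klip: "1-lipschitz_on UNIV k" by (rule lipschitz_onI_DERIV[OF k g(2)]) simp
    have int: "integrable M (\<lambda>\<omega>. h (quad a \<omega>))" if h: "1-lipschitz_on UNIV h" for h :: "real \<Rightarrow> real"
    proof (rule Bochner_Integration.integrable_bound[OF Bochner_Integration.integrable_add
          [OF integrable_const[of "\<bar>h 0\<bar>"] integrable_abs[OF integrable_quad[of a]]]])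
      have [measurable]: "h \<in> borel_measurable borel"
        by (intro borel_measurable_continuous_onI lipschitz_on_continuous_on[OF h])
      show "(\<lambda>\<omega>. h (quad a \<omega>)) \<in> borel_measurable M" by measurable
      show "AE \<omega> in M. norm (h (quad a \<omega>)) \<le> norm (\<bar>h 0\<bar> + \<bar>quad a \<omega>\<bar>)"
        using lipschitz_onD[OF h, of _ 0] by (intro AE_I2) (smt (verit) UNIV_I dist_real_def mult_1 real_norm_def)
    qed
    have 1: "\<bar>expectation (\<lambda>\<omega>. h (quad a \<omega>)) - expectation (\<lambda>\<omega>. k (quad a \<omega>))\<bar> \<le> e / 2"
    proof -
      have "\<bar>expectation (\<lambda>\<omega>. k (quad a \<omega>) - h (quad a \<omega>))\<bar> \<le> expectation (\<lambda>\<omega>. e / 2)"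
        using int[OF h] int[OF klip] kh
        by (intro order_trans[OF integral_abs_bound] integral_mono) auto
      then show ?thesis using int[OF h] int[OF klip] by (simp add: prob_space abs_minus_commute)
    qed
    have 2: "\<bar>(\<integral>x. std_normal_density x * h x \<partial>lborel) - (\<integral>x. std_normal_density x * k x \<partial>lborel)\<bar> \<le> e / 2"
    proof -
      note i = integrable_std_normal_density_mult_lipschitz[OF h] integrable_std_normal_density_mult_lipschitz[OF klip]
      have "\<bar>\<integral>x. std_normal_density x * k x - std_normal_density x * h x \<partial>lborel\<bar> \<le> (\<integral>x. std_normal_density x * (e / 2) \<partial>lborel)"
      proof (intro order_trans[OF integral_abs_bound] integral_mono)
        show "\<bar>std_normal_density x * k x - std_normal_density x * h x\<bar> \<le> std_normal_density x * (e / 2)" for x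
          using mult_left_mono[OF kh[of x] normal_density_nonneg[of 0 1 x]]
          by (simp add: right_diff_distrib[symmetric] abs_mult)
      qed (use i in auto)
      then show ?thesis using i by (simp add: abs_minus_commute)
    qed
    show ?thesis using smooth[OF k g] 1 2 by linarith
  qed
  then show ?thesis by (rule field_le_epsilon)
qed

end

section \<open>The extended-real bound, with an infinite fourth moment as a separate case\<close>

theorem corollary6p2:
  fixes M :: "'a measure" and X :: "nat \<Rightarrow> 'a \<Rightarrow> real"
    and P :: "'b measure" and Z :: "'b \<Rightarrow> real"
    and n :: nat and a :: "nat \<Rightarrow> nat \<Rightarrow> real"
  assumes "prob_space M"
    and "prob_space.indep_vars M (\<lambda>_. borel) X {1..}"
    and "\<And>k. k \<ge> 1 \<Longrightarrow> distr M borel (X k) = distr M borel (X 1)"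
    and "\<And>k. k \<ge> 1 \<Longrightarrow> (\<integral>\<omega>. X k \<omega> \<partial>M) = 0"
    and "\<And>k. k \<ge> 1 \<Longrightarrow> (\<integral>\<omega>. (X k \<omega>)\<^sup>2 \<partial>M) = 1"
    and "n \<ge> 2"
    and "\<And>k l. k \<in> {1..n} \<Longrightarrow> l \<in> {1..n} \<Longrightarrow> a k l = a l k"
    and "\<And>k. k \<in> {1..n} \<Longrightarrow> a k k = 0"
    and "(\<integral>\<omega>. quadratic_form_rv n a X \<omega> \<partial>M) = 0"
    and "(\<integral>\<omega>. (quadratic_form_rv n a X \<omega>)\<^sup>2 \<partial>M) = 1"
    and "prob_space P"
    and "distributed P lborel Z std_normal_density"
  shows "wasserstein_dist M (quadratic_form_rv n a X) P Z \<le>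
      2 * ennreal_sqrt
            (fourth_moment M (X 1) * ennreal (\<Sum>l=1..n. (\<Sum>k=1..n. (a k l)\<^sup>2)\<^sup>2)
             + 2 * ennreal (\<Sum>l=1..n. \<Sum>p=1..n. (\<Sum>k=1..n. a k l * a k p)\<^sup>2))
    + 4 * ennreal_sqrt
            ((3 * fourth_moment M (X 1) + (fourth_moment M (X 1))\<^sup>2)
             * ennreal (\<Sum>k=1..n. (\<Sum>l=1..n. (a k l)\<^sup>2)\<^sup>2))"
proof -
  interpret prob_space M by fact
  define S1 where "S1 = (\<Sum>l=1..n. (\<Sum>k=1..n. (a k l)\<^sup>2)\<^sup>2)"
  define S2 where "S2 = (\<Sum>k=1..n. (\<Sum>l=1..n. (a k l)\<^sup>2)\<^sup>2)"
  define H where "H = (\<Sum>l=1..n. \<Sum>p=1..n. (\<Sum>k=1..n. a k l * a k p)\<^sup>2)"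
  have nonneg: "S1 \<ge> 0" "S2 \<ge> 0" "H \<ge> 0"
    by (simp_all add: S1_def S2_def H_def sum_nonneg)
  have [measurable]: "X k \<in> borel_measurable M" if "k \<ge> 1" for k
    using assms(2) that by (auto simp: indep_vars_def)
  show ?thesis
  proof (cases "fourth_moment M (X 1) = \<infinity>")
    case True
    \<comment> \<open>This matters because infinity times 0 is 0 in \<open>ennreal\<close>: a
      nonzero \<open>S1\<close> makes the right-hand side infinite. If it vanished, all coefficients
      and hence the form would be zero, against its second moment 1.\<close>
    have "S1 \<noteq> 0"
    proof
      assume "S1 = 0"
      then have "\<forall>l\<in>{1..n}. (\<Sum>k=1..n. (a k l)\<^sup>2)\<^sup>2 = 0"
        unfolding S1_def by (subst (asm) sum_nonneg_eq_0_iff) auto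
      then have "\<forall>l\<in>{1..n}. \<forall>k\<in>{1..n}. (a k l)\<^sup>2 = 0"
        by (auto simp: sum_nonneg_eq_0_iff)
      then have "quadratic_form_rv n a X \<omega> = 0" for \<omega>
        by (simp add: quadratic_form_rv_def)
      with assms(10) show False by simp
    qed
    then have "fourth_moment M (X 1) * ennreal S1 = \<infinity>"
      using True nonneg by (simp add: ennreal_top_mult)
    then have "ennreal_sqrt (fourth_moment M (X 1) * ennreal S1 + 2 * ennreal H) = \<infinity>"
      by (simp add: ennreal_sqrt_def)
    then show ?thesis
      unfolding S1_def[symmetric] H_def[symmetric] by (simp add: ennreal_mult_top)
  next
    case False
    define m4 where "m4 = enn2real (fourth_moment M (X 1))"
    have fin: "fourth_moment M (X 1) < \<infinity>" using False by (simp add: less_top)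
    have m4: "fourth_moment M (X 1) = ennreal m4" "m4 \<ge> 0"
      using fin by (simp_all add: m4_def)
    have int1: "integrable M (\<lambda>\<omega>. X 1 \<omega> ^ 4)"
      using fin by (intro integrableI_nonneg) (auto simp: fourth_moment_def)
    have E1: "expectation (\<lambda>\<omega>. X 1 \<omega> ^ 4) = m4"
      unfolding m4_def fourth_moment_def using int1 by (subst integral_eq_nn_integral) auto
    interpret indep_standardized M X "{1..n}" m4
    proof
      show "finite {1..n}" by simp
      show "indep_vars (\<lambda>_. borel) X {1..n}"
        by (rule indep_vars_subset[OF assms(2)]) auto
      show "expectation (X k) = 0" "expectation (\<lambda>\<omega>. (X k \<omega>)\<^sup>2) = 1" if "k \<in> {1..n}" for k
        using that assms(4,5) by auto
      fix k assume "k \<in> {1..n}"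
      then have k: "k \<ge> 1" by simp
      \<comment> \<open>Fourth moments pass from \<open>X 1\<close> to \<open>X k\<close> through
        their common law.\<close>
      have i4: "integrable (distr M borel (X k)) (\<lambda>x. x ^ 4)"
        unfolding assms(3)[OF k] using int1 by (simp add: integrable_distr_eq)
      then show "integrable M (\<lambda>\<omega>. X k \<omega> ^ 4)"
        using k by (simp add: integrable_distr_eq)
      have "expectation (\<lambda>\<omega>. X k \<omega> ^ 4) = (\<integral>x. x ^ 4 \<partial>distr M borel (X k))"
        using k by (simp add: integral_distr)
      also have "\<dots> = m4"
        unfolding assms(3)[OF k] using E1 by (simp add: integral_distr)
      finally show "expectation (\<lambda>\<omega>. X k \<omega> ^ 4) = m4" .
    qed
    have Q: "quadratic_form_rv n a X = quad a"
      unfolding fun_eq_iff quadratic_form_rv_def quad_def by (simp add: mult.assoc)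
    define B where "B = 2 * sqrt (m4 * S1 + 2 * H) + 4 * sqrt ((3 * m4 + m4\<^sup>2) * S2)"
    have "wasserstein_dist M (quadratic_form_rv n a X) P Z \<le> ennreal B"
      unfolding wasserstein_dist_def
    proof (rule SUP_least)
      fix h :: "real \<Rightarrow> real" assume "h \<in> {h. 1-lipschitz_on UNIV h}"
      then have h: "1-lipschitz_on UNIV h" by simp
      have [measurable]: "h \<in> borel_measurable borel"
        by (intro borel_measurable_continuous_onI lipschitz_on_continuous_on[OF h])
      have Z: "(\<integral>\<omega>. h (Z \<omega>) \<partial>P) = (\<integral>x. std_normal_density x * h x \<partial>lborel)"
        using distributed_integral[OF assms(12), of h] by simp
      have "\<bar>expectation (\<lambda>\<omega>. h (quad a \<omega>)) - (\<integral>x. std_normal_density x * h x \<partial>lborel)\<bar> \<le> B"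
        unfolding B_def S1_def S2_def H_def
        by (rule quad_normal_approximation) (use assms(7,8,10) h Q in auto)
      then show "ennreal \<bar>(\<integral>\<omega>. h (quadratic_form_rv n a X \<omega>) \<partial>M) - (\<integral>\<omega>. h (Z \<omega>) \<partial>P)\<bar> \<le> ennreal B"
        unfolding Q Z by (rule ennreal_leI)
    qed
    also have "ennreal B = 2 * ennreal_sqrt (ennreal m4 * ennreal S1 + 2 * ennreal H)
        + 4 * ennreal_sqrt ((3 * ennreal m4 + (ennreal m4)\<^sup>2) * ennreal S2)"
    proof -
      \<comment> \<open>With the numerals written as images of reals, all arithmetic moves inside
        \<open>ennreal\<close>.\<close>
      have c: "2 = ennreal 2" "3 = ennreal 3" "4 = ennreal 4" by simp_all
      have e1: "ennreal m4 * ennreal S1 + 2 * ennreal H = ennreal (m4 * S1 + 2 * H)"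
        unfolding c using m4(2) nonneg by (simp add: ennreal_mult ennreal_plus del: ennreal_numeral)
      have e2: "(3 * ennreal m4 + (ennreal m4)\<^sup>2) * ennreal S2 = ennreal ((3 * m4 + m4\<^sup>2) * S2)"
        unfolding c using m4(2) nonneg
        by (simp add: ennreal_mult ennreal_plus ennreal_power del: ennreal_numeral)
      have pos: "0 \<le> m4 * S1 + 2 * H" "0 \<le> (3 * m4 + m4\<^sup>2) * S2"
        using m4(2) nonneg by auto
      show ?thesis
        unfolding e1 e2 ennreal_sqrt_ennreal[OF pos(1)] ennreal_sqrt_ennreal[OF pos(2)] unfolding B_def c(1,3)
        using pos by (simp add: ennreal_mult[symmetric] ennreal_plus[symmetric] del: ennreal_numeral ennreal_plus)
    qed
    finally show ?thesis unfolding m4(1) S1_def S2_def H_def .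
  qed
qed

end
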